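(* Let $(M,\Delta)$ be a graded bundle of degree at most $3$ and let $X$ be a weight $-1$ vector field on $M$, given locally in graded coordinates $(x^i,y_1^s,y_2^S,y_3^\sigma)$ (the lower index indicates the weight, the $x^i$ being base coordinates) by $$X=F^s(x)\partial_{y_1^s}+G^S_s(x)y_1^s\partial_{y_2^S}+\Big(H^\sigma_S(x)y_2^S+\tfrac12I^\sigma_{sr}(x)y_1^sy_1^r\Big)\partial_{y_3^\sigma},$$ where $F^s,G^S_s,H^\sigma_S,I^\sigma_{sr}$ are smooth functions on the base (summation over repeated indices). Then the right action $M\times\mathcal G_2^{\mathrm{inv}}\to M$ given by $p.(a,b)=X^{b/a}(h_a(p))=h_a(X^{b/a^2}(p))$ extends to a smooth right action of $\mathcal G_2$ on $M$ if and only if $F^s=0$ and $H^\sigma_SG^S_s=0$ (sum over $S$) for all indices $s$ and $\sigma$. Equivalently, if and only if $X$ is a weight $-1$ vector field tangent to the fibration $M=M^3\to M^1$ such that the weight $-2$ differential operator $X\circ X$ vanishes on all functions on $M$ of weight less than or equal to $3$.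
   Context: $\mathcal G_2$ is the monoid of second jets at $0$ of maps $\phi:(\mathbb R,0)\to(\mathbb R,0)$ under composition; it is identified with $\mathbb R^2=\{(a,b)\}$ (the class of $\phi(t)=at+\frac12bt^2$), with multiplication $(a,b)(A,B)=(aA,\,aB+bA^2)$ and unit $(1,0)$; $\mathcal G_2^{\mathrm{inv}}=\{(a,b):a\ne0\}$ is its group of invertible elements. A (real) graded space of rank $\mathbf d=(d_1,\dots,d_k)$ is a manifold diffeomorphic to $\mathbb R^{d_1+\dots+d_k}$ with an equivalence class of global coordinate systems $(y^\alpha)$ with positive integer weights $w^\alpha$ ($d_i$ coordinates of weight $i$), two systems being equivalent if each new coordinate of weight $w$ is a real polynomial in the old ones all of whose monomials $y^{\alpha_1}\cdots y^{\alpha_j}$, $j\ge1$, satisfy $w^{\alpha_1}+\dots+w^{\alpha_j}=w$. The degree is the highest weight that occurs. A graded bundle $M\to M_0$ is a smooth fiber bundle with typical fiber a graded space and with transition maps that are isomorphisms of graded spaces on fibers. Its homotheties are $h_t(x,(y^\alpha))=(x,(t^{w^\alpha}y^\alpha))$, $t\in\mathbb R$, and its weight vector field is $\Delta=\frac{d}{dt}|_{t=1}h_t$. A function $f$ has weight $w$ if $f\circ h_t=t^wf$ for all $t\in\mathbb R$. A vector field $Z$ has weight $w$ if $[\Delta,Z]=wZ$; a weight $-1$ vector field on a graded bundle of degree at most $3$ always has the local form displayed in the claim, and it is complete. $t\mapsto X^t$ is the flow of $X$; for a complete vector field $X$ of weight $-1$ the formula $p.(a,b)=X^{b/a}(h_a(p))=h_a(X^{b/a^2}(p))$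 defines a smooth right action of $\mathcal G_2^{\mathrm{inv}}$. For a graded bundle $M=M^3$ of degree at most $3$, $M^1$ is the quotient of $M$ obtained by keeping only the coordinates of weight at most $1$, i.e. the projection $M^3\to M^1$ is $(x^i,y_1^s,y_2^S,y_3^\sigma)\mapsto(x^i,y_1^s)$. A vector field is tangent to this fibration if it is tangent to its fibers. *)

theory Defs
  imports "HOL-Analysis.Analysis"
begin

section \<open>Smooth maps and smooth atlases\<close>

text \<open>For an open set \<open>S\<close>, \<open>Ck_on k S f\<close> says that \<open>f\<close> is of class \<open>C\<^sup>k\<close> on \<open>S\<close>
  (in the finite-dimensional spaces used below).\<close>

fun Ck_on :: "nat \<Rightarrow> 'a::real_normed_vector set \<Rightarrow> ('a \<Rightarrow> 'b::real_normed_vector) \<Rightarrow> bool" where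
  "Ck_on 0 S f \<longleftrightarrow> continuous_on S f"
| "Ck_on (Suc k) S f \<longleftrightarrow>
     (\<forall>x\<in>S. f differentiable (at x)) \<and>
     (\<forall>v. Ck_on k S (\<lambda>x. frechet_derivative f (at x) v))"

definition smooth_on :: "'a::real_normed_vector set \<Rightarrow> ('a \<Rightarrow> 'b::real_normed_vector) \<Rightarrow> bool" where
  "smooth_on S f \<longleftrightarrow> (\<forall>k. Ck_on k S f)"

text \<open>Coordinate spaces are indexed by a subset \<open>J\<close> of a finite type, so that every
  dimension, including \<open>0\<close>, occurs: \<open>coord_space J\<close> is a copy of \<open>\<real>\<^sup>J\<close> inside
  \<open>real ^ 'i\<close>, and \<open>restr J\<close> is the coordinate projection onto it.\<close>

definition coord_space :: "'i::finite set \<Rightarrow> (real ^ 'i) set" where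
  "coord_space J = {v. \<forall>i. i \<notin> J \<longrightarrow> v $ i = 0}"

definition restr :: "'i::finite set \<Rightarrow> real ^ 'i \<Rightarrow> real ^ 'i" where
  "restr J v = (\<chi> i. if i \<in> J then v $ i else 0)"

text \<open>A chart is a pair of its domain and its coordinate map.\<close>

type_synonym ('x, 'i) chart = "'x set \<times> ('x \<Rightarrow> real ^ 'i)"

definition is_chart :: "'i::finite set \<Rightarrow> ('x::topological_space, 'i) chart \<Rightarrow> bool" where
  "is_chart J c \<longleftrightarrow>
     open (fst c) \<and>
     openin (top_of_set (coord_space J)) (snd c ` fst c) \<and>
     (\<exists>g. homeomorphism (fst c) (snd c ` fst c) (snd c) g)"

text \<open>The inverse of a chart, precomposed with the projection \<open>restr J\<close>, so that it is
  defined on an open subset of \<open>real ^ 'i\<close>.  A function \<open>g\<close> on an open subset \<open>W\<close> of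
  \<open>coord_space J\<close> is smooth iff \<open>g \<circ> restr J\<close> is smooth on the open set \<open>restr J -` W\<close>.\<close>

definition chart_dom :: "'i::finite set \<Rightarrow> ('x, 'i) chart \<Rightarrow> (real ^ 'i) set" where
  "chart_dom J c = {v. restr J v \<in> snd c ` fst c}"

definition chart_param :: "'i::finite set \<Rightarrow> ('x, 'i) chart \<Rightarrow> real ^ 'i \<Rightarrow> 'x" where
  "chart_param J c v = inv_into (fst c) (snd c) (restr J v)"

definition smooth_atlas :: "'i::finite set \<Rightarrow> ('x::topological_space, 'i) chart set \<Rightarrow> bool" where
  "smooth_atlas J A \<longleftrightarrow>
     (\<forall>c\<in>A. is_chart J c) \<and>
     (\<Union>c\<in>A. fst c) = UNIV \<and>
     (\<forall>c\<in>A. \<forall>c'\<in>A.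
        smooth_on {v \<in> chart_dom J c. chart_param J c v \<in> fst c'}
          (\<lambda>v. snd c' (chart_param J c v)))"

text \<open>Smooth real functions on an open subset \<open>U\<close> of a manifold with atlas \<open>A\<close>, and smooth
  maps from an open subset \<open>S\<close> of a normed space into that manifold.\<close>

definition smooth_fun_on ::
  "'i::finite set \<Rightarrow> ('x, 'i) chart set \<Rightarrow> 'x set \<Rightarrow> ('x \<Rightarrow> real) \<Rightarrow> bool" where
  "smooth_fun_on J A U f \<longleftrightarrow>
     (\<forall>c\<in>A. smooth_on {v \<in> chart_dom J c. chart_param J c v \<in> U} (\<lambda>v. f (chart_param J c v)))"

definition smooth_into ::
  "('x::topological_space, 'i::finite) chart set \<Rightarrow> 'e::real_normed_vector set \<Rightarrow> ('e \<Rightarrow> 'x) \<Rightarrow> bool" where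
  "smooth_into A S g \<longleftrightarrow>
     continuous_on S g \<and>
     (\<forall>c\<in>A. smooth_on {e \<in> S. g e \<in> fst c} (\<lambda>e. snd c (g e)))"


section \<open>Graded bundles\<close>

text \<open>\<open>weighted_poly K w k P\<close>: on \<open>\<real>\<^sup>K\<close>, \<open>P\<close> is a real polynomial all of whose monomials
  have weight exactly \<open>k\<close>, the variable \<open>i\<close> having weight \<open>w i\<close>.  Monomials are given by
  their exponents \<open>m\<close>.  If \<open>k > 0\<close>, there is no constant term.\<close>

definition weighted_poly ::
  "'i::finite set \<Rightarrow> ('i \<Rightarrow> nat) \<Rightarrow> nat \<Rightarrow> (real ^ 'i \<Rightarrow> real) \<Rightarrow> bool" where
  "weighted_poly K w k P \<longleftrightarrow>
     (\<exists>(E :: ('i \<Rightarrow> nat) set) (a :: ('i \<Rightarrow> nat) \<Rightarrow> real).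
        finite E \<and>
        (\<forall>m\<in>E. (\<Sum>i\<in>K. m i * w i) = k) \<and>
        (\<forall>v. P v = (\<Sum>m\<in>E. a m * (\<Prod>i\<in>K. (v $ i) ^ m i))))"

text \<open>The data of a fibre bundle with total space the type \<open>'m\<close> and base manifold the type
  \<open>'b\<close>.  Coordinates are indexed by \<open>idx\<close>; those of weight \<open>0\<close> are the base coordinates,
  those of positive weight are the coordinates of the typical fibre.  A local trivialization
  \<open>(U, y)\<close> consists of an open subset \<open>U\<close> of the base and the fibre component \<open>y\<close> of a
  bijection from the preimage of \<open>U\<close> to \<open>U \<times> \<real>\<^sup>d\<close>.\<close>

record ('m, 'b, 'i::finite) fibre_bundle =
  idx :: "'i set"
  wt :: "'i \<Rightarrow> nat"
  bproj :: "'m \<Rightarrow> 'b"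
  base_atlas :: "('b set \<times> ('b \<Rightarrow> real ^ 'i)) set"
  trivs :: "('b set \<times> ('m \<Rightarrow> real ^ 'i)) set"

definition idx_of :: "('m, 'b, 'i::finite) fibre_bundle \<Rightarrow> nat \<Rightarrow> 'i set" where
  "idx_of M k = {i \<in> idx M. wt M i = k}"

definition fib_idx :: "('m, 'b, 'i::finite) fibre_bundle \<Rightarrow> 'i set" where
  "fib_idx M = {i \<in> idx M. wt M i > 0}"

text \<open>The graded coordinates \<open>(x, y)\<close> on the total space that are determined by a base chart
  and a local trivialization; the pair \<open>(x, y)\<close> is encoded as the sum of the two vectors, which
  have complementary supports.\<close>

definition graded_chart ::
  "('m, 'b, 'i::finite) fibre_bundle \<Rightarrow> ('b, 'i) chart \<Rightarrow> 'b set \<times> ('m \<Rightarrow> real ^ 'i) \<Rightarrow> ('m, 'i) chart" where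
  "graded_chart M b T =
     (bproj M -` (fst b \<inter> fst T), \<lambda>p. snd b (bproj M p) + snd T p)"

text \<open>The smooth structure of the total space is the one for which the local trivializations
  are diffeomorphisms onto the products \<open>U \<times> \<real>\<^sup>d\<close>.\<close>

definition total_atlas :: "('m, 'b, 'i::finite) fibre_bundle \<Rightarrow> ('m, 'i) chart set" where
  "total_atlas M = {graded_chart M b T | b T. b \<in> base_atlas M \<and> T \<in> trivs M}"

definition graded_bundle ::
  "('m::{t2_space, second_countable_topology},
    'b::{t2_space, second_countable_topology}, 'i::finite) fibre_bundle \<Rightarrow> bool" where
  "graded_bundle M \<longleftrightarrow>
     smooth_atlas (idx_of M 0) (base_atlas M) \<and>
     (\<forall>T\<in>trivs M. open (fst T) \<and>
        (\<exists>g. homeomorphism (bproj M -` fst T) (fst T \<times> coord_space (fib_idx M))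
               (\<lambda>p. (bproj M p, snd T p)) g)) \<and>
     (\<Union>T\<in>trivs M. fst T) = UNIV \<and>
     smooth_atlas (idx M) (total_atlas M) \<and>
     (\<forall>T\<in>trivs M. \<forall>T'\<in>trivs M. \<forall>x \<in> fst T \<inter> fst T'. \<forall>i\<in>fib_idx M.
        \<exists>P. weighted_poly (fib_idx M) (wt M) (wt M i) P \<and>
            (\<forall>p. bproj M p = x \<longrightarrow> snd T' p $ i = P (snd T p)))"

definition degree_at_most :: "('m, 'b, 'i::finite) fibre_bundle \<Rightarrow> nat \<Rightarrow> bool" where
  "degree_at_most M k \<longleftrightarrow> (\<forall>i\<in>idx M. wt M i \<le> k)"

text \<open>The conditions for the different trivializations around \<open>p\<close> agree, because the transition
  polynomials are weighted homogeneous.\<close>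

definition homothety :: "('m, 'b, 'i::finite) fibre_bundle \<Rightarrow> real \<Rightarrow> 'm \<Rightarrow> 'm" where
  "homothety M t p =
     (THE q. bproj M q = bproj M p \<and>
        (\<forall>T\<in>trivs M. bproj M p \<in> fst T \<longrightarrow>
           (\<forall>i\<in>fib_idx M. snd T q $ i = t ^ wt M i * snd T p $ i)))"

abbreviation smooth_fun :: "('m, 'b, 'i::finite) fibre_bundle \<Rightarrow> ('m \<Rightarrow> real) \<Rightarrow> bool" where
  "smooth_fun M f \<equiv> smooth_fun_on (idx M) (total_atlas M) UNIV f"

definition fun_has_weight :: "('m, 'b, 'i::finite) fibre_bundle \<Rightarrow> nat \<Rightarrow> ('m \<Rightarrow> real) \<Rightarrow> bool" where
  "fun_has_weight M k f \<longleftrightarrow> (\<forall>t p. f (homothety M t p) = t ^ k * f p)"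

text \<open>The fibre of the projection \<open>M \<rightarrow> M\<^sup>1\<close> through \<open>p\<close>; the points of the quotient \<open>M\<^sup>1\<close>
  are these fibres.\<close>

definition M1_proj :: "('m, 'b, 'i::finite) fibre_bundle \<Rightarrow> 'm \<Rightarrow> 'm set" where
  "M1_proj M p =
     {q. bproj M q = bproj M p \<and>
        (\<forall>T\<in>trivs M. bproj M p \<in> fst T \<longrightarrow> (\<forall>i\<in>idx_of M 1. snd T q $ i = snd T p $ i))}"


section \<open>Vector fields\<close>

text \<open>Vector fields are derivations of the algebra of smooth functions on the total space;
  their values on functions that are not smooth are irrelevant.\<close>

type_synonym 'm operator = "('m \<Rightarrow> real) \<Rightarrow> ('m \<Rightarrow> real)"

definition vector_field :: "('m, 'b, 'i::finite) fibre_bundle \<Rightarrow> 'm operator \<Rightarrow> bool" where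
  "vector_field M X \<longleftrightarrow>
     (\<forall>f. smooth_fun M f \<longrightarrow> smooth_fun M (X f)) \<and>
     (\<forall>f g. smooth_fun M f \<longrightarrow> smooth_fun M g \<longrightarrow>
        X (\<lambda>p. f p + g p) = (\<lambda>p. X f p + X g p) \<and>
        X (\<lambda>p. f p * g p) = (\<lambda>p. X f p * g p + f p * X g p)) \<and>
     (\<forall>f c. smooth_fun M f \<longrightarrow> X (\<lambda>p. c * f p) = (\<lambda>p. c * X f p))"

definition weight_vector_field :: "('m, 'b, 'i::finite) fibre_bundle \<Rightarrow> 'm operator" where
  "weight_vector_field M f = (\<lambda>p. deriv (\<lambda>t. f (homothety M t p)) 1)"

definition lie_bracket :: "'m operator \<Rightarrow> 'm operator \<Rightarrow> 'm operator" where
  "lie_bracket X Y f = (\<lambda>p. X (Y f) p - Y (X f) p)"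

definition vf_has_weight :: "('m, 'b, 'i::finite) fibre_bundle \<Rightarrow> int \<Rightarrow> 'm operator \<Rightarrow> bool" where
  "vf_has_weight M k X \<longleftrightarrow>
     (\<forall>f. smooth_fun M f \<longrightarrow>
        lie_bracket (weight_vector_field M) X f = (\<lambda>p. of_int k * X f p))"

text \<open>The velocity of the curve \<open>\<gamma>\<close> at time \<open>t\<close> is the value of \<open>X\<close> at \<open>\<gamma> t\<close>.\<close>

definition has_velocity ::
  "('m, 'b, 'i::finite) fibre_bundle \<Rightarrow> (real \<Rightarrow> 'm) \<Rightarrow> real \<Rightarrow> 'm operator \<Rightarrow> bool" where
  "has_velocity M \<gamma> t X \<longleftrightarrow>
     (\<forall>f. smooth_fun M f \<longrightarrow> ((\<lambda>s. f (\<gamma> s)) has_real_derivative X f (\<gamma> t)) (at t))"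

definition integral_curve ::
  "('m::topological_space, 'b, 'i::finite) fibre_bundle \<Rightarrow> 'm operator \<Rightarrow> (real \<Rightarrow> 'm) \<Rightarrow> bool" where
  "integral_curve M X \<gamma> \<longleftrightarrow>
     smooth_into (total_atlas M) UNIV \<gamma> \<and> (\<forall>t. has_velocity M \<gamma> t X)"

text \<open>The flow of a complete vector field (a field of weight \<open>-1\<close> in degree at most \<open>3\<close> is
  complete).\<close>

definition flow ::
  "('m::topological_space, 'b, 'i::finite) fibre_bundle \<Rightarrow> 'm operator \<Rightarrow> real \<Rightarrow> 'm \<Rightarrow> 'm" where
  "flow M X t p = (THE \<gamma>. integral_curve M X \<gamma> \<and> \<gamma> 0 = p) t"

definition tangent_to_M1_fibres ::
  "('m::topological_space, 'b, 'i::finite) fibre_bundle \<Rightarrow> 'm operator \<Rightarrow> bool" where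
  "tangent_to_M1_fibres M X \<longleftrightarrow>
     (\<forall>p. \<exists>\<gamma>. smooth_into (total_atlas M) UNIV \<gamma> \<and> \<gamma> 0 = p \<and>
            (\<forall>t. \<gamma> t \<in> M1_proj M p) \<and> has_velocity M \<gamma> 0 X)"

definition partial ::
  "('m, 'b, 'i::finite) fibre_bundle \<Rightarrow> ('m, 'i) chart \<Rightarrow> 'i \<Rightarrow> ('m \<Rightarrow> real) \<Rightarrow> 'm \<Rightarrow> real" where
  "partial M c i f p =
     frechet_derivative (\<lambda>v. f (chart_param (idx M) c v)) (at (snd c p)) (axis i 1)"

text \<open>\<open>X\<close> is given, in the graded coordinates determined by \<open>b\<close> and \<open>T\<close>, by
  \<open>X = F\<^sup>s \<partial>y\<^sub>1\<^sup>s + G\<^sup>S\<^sub>s y\<^sub>1\<^sup>s \<partial>y\<^sub>2\<^sup>S + (H\<^sup>\<sigma>\<^sub>S y\<^sub>2\<^sup>S + 1/2 I\<^sup>\<sigma>\<^sub>s\<^sub>r y\<^sub>1\<^sup>s y\<^sub>1\<^sup>r) \<partial>y\<^sub>3\<^sup>\<sigma>\<close>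
  (sums over the indices \<open>s, r, S, \<sigma>\<close> of weights \<open>1, 1, 2, 3\<close>),
  with coefficients that are smooth functions on the corresponding open subset of the base.
  The upper index is the first argument.\<close>

definition local_form ::
  "('m, 'b, 'i::finite) fibre_bundle \<Rightarrow> ('b, 'i) chart \<Rightarrow> 'b set \<times> ('m \<Rightarrow> real ^ 'i) \<Rightarrow> 'm operator \<Rightarrow>
   ('i \<Rightarrow> 'b \<Rightarrow> real) \<Rightarrow> ('i \<Rightarrow> 'i \<Rightarrow> 'b \<Rightarrow> real) \<Rightarrow> ('i \<Rightarrow> 'i \<Rightarrow> 'b \<Rightarrow> real) \<Rightarrow>
   ('i \<Rightarrow> 'i \<Rightarrow> 'i \<Rightarrow> 'b \<Rightarrow> real) \<Rightarrow> bool" where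
  "local_form M b T X F G H I \<longleftrightarrow>
     (let U = fst b \<inter> fst T;
          J1 = idx_of M 1; J2 = idx_of M 2; J3 = idx_of M 3;
          sm = smooth_fun_on (idx_of M 0) (base_atlas M) U;
          D = partial M (graded_chart M b T)
      in (\<forall>s\<in>J1. sm (F s)) \<and>
         (\<forall>S\<in>J2. \<forall>s\<in>J1. sm (G S s)) \<and>
         (\<forall>\<sigma>\<in>J3. \<forall>S\<in>J2. sm (H \<sigma> S)) \<and>
         (\<forall>\<sigma>\<in>J3. \<forall>s\<in>J1. \<forall>r\<in>J1. sm (I \<sigma> s r)) \<and>
         (\<forall>f p. smooth_fun M f \<longrightarrow> bproj M p \<in> U \<longrightarrow>
            (let x = bproj M p; y = (\<lambda>i. snd T p $ i)
             in X f p =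
                  (\<Sum>s\<in>J1. F s x * D s f p) +
                  (\<Sum>S\<in>J2. (\<Sum>s\<in>J1. G S s x * y s) * D S f p) +
                  (\<Sum>\<sigma>\<in>J3. ((\<Sum>S\<in>J2. H \<sigma> S x * y S) +
                            1/2 * (\<Sum>s\<in>J1. \<Sum>r\<in>J1. I \<sigma> s r x * y s * y r)) * D \<sigma> f p))))"


section \<open>The monoid of second jets and its actions\<close>

text \<open>\<open>(a, b)\<close> is the second jet at \<open>0\<close> of \<open>t \<mapsto> a t + b t\<^sup>2 / 2\<close>; the product is the jet of
  the composition.\<close>

definition G2_mult :: "real \<times> real \<Rightarrow> real \<times> real \<Rightarrow> real \<times> real" where
  "G2_mult = (\<lambda>(a, b) (A, B). (a * A, a * B + b * A\<^sup>2))"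

definition G2_one :: "real \<times> real" where
  "G2_one = (1, 0)"

definition smooth_right_G2_action ::
  "('m::topological_space, 'b, 'i::finite) fibre_bundle \<Rightarrow> ('m \<Rightarrow> real \<times> real \<Rightarrow> 'm) \<Rightarrow> bool" where
  "smooth_right_G2_action M \<rho> \<longleftrightarrow>
     (\<forall>c\<in>total_atlas M.
        smooth_into (total_atlas M) (chart_dom (idx M) c \<times> UNIV)
          (\<lambda>(v, g). \<rho> (chart_param (idx M) c v) g)) \<and>
     (\<forall>p. \<rho> p G2_one = p) \<and>
     (\<forall>p g h. \<rho> (\<rho> p g) h = \<rho> p (G2_mult g h))"

text \<open>The action of the group of invertible jets (those with \<open>a \<noteq> 0\<close>) determined by a vector
  field of weight \<open>-1\<close>.  For such a field the value is also
  \<open>homothety M a (flow M X (b / a\<^sup>2) p)\<close>.\<close>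

definition G2_inv_action ::
  "('m::topological_space, 'b, 'i::finite) fibre_bundle \<Rightarrow> 'm operator \<Rightarrow> 'm \<Rightarrow> real \<times> real \<Rightarrow> 'm" where
  "G2_inv_action M X p = (\<lambda>(a, b). flow M X (b / a) (homothety M a p))"

definition extends_to_G2_action ::
  "('m::topological_space, 'b, 'i::finite) fibre_bundle \<Rightarrow> 'm operator \<Rightarrow> bool" where
  "extends_to_G2_action M X \<longleftrightarrow>
     (\<exists>\<rho>. smooth_right_G2_action M \<rho> \<and>
        (\<forall>p a b. a \<noteq> 0 \<longrightarrow> \<rho> p (a, b) = G2_inv_action M X p (a, b)))"

end

theory Submission
  imports Defs
begin

text \<open>
  Over a fixed base point, a field of the given local form is triangular, so its integral curves
  are explicit polynomials of degree at most \<open>3\<close> in the time.  Hence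
  \<open>p.(a, b)\<close> is polynomial in \<open>a\<close>, \<open>b\<close> and \<open>1/a\<close>; the only negative powers of \<open>a\<close> that can
  remain have coefficients built from \<open>F\<close> and \<open>HG\<close>, which must vanish if the action extends
  continuously to \<open>a = 0\<close>.  If they do vanish, the remaining polynomial
  \<open>(x, a y\<^sub>1, a\<^sup>2 y\<^sub>2 + b G y\<^sub>1, a\<^sup>3 y\<^sub>3 + a b (H y\<^sub>2 + I(y\<^sub>1, y\<^sub>1) / 2))\<close>
  is the extension.

  For the second characterization, let \<open>f\<close> have weight \<open>k \<le> 3\<close> and put
  \<open>u(t) = f(p.(1, t))\<close>.  Then \<open>f(p.(a, a\<^sup>2 t)) = a\<^sup>k u(t)\<close>; differentiating twice in \<open>t\<close>
  gives \<open>a\<^sup>4 \<partial>\<^sub>b\<^sup>2 f(p.(a, b)) = a\<^sup>k u''(0)\<close> at \<open>b = 0\<close>, and \<open>a \<longlongrightarrow> 0\<close> forces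
  \<open>(X \<circ> X) f (p) = u''(0) = 0\<close>.  Conversely, \<open>X \<circ> X\<close> maps a weight \<open>3\<close> coordinate to \<open>H G y\<^sub>1\<close> when
  \<open>F = 0\<close>.
\<close>

section \<open>Calculus of smooth maps\<close>

text \<open>A vector field is a derivation of globally defined functions here, so a local coordinate
  cannot be fed to it. The substitute is a coordinate times a cutoff that depends on base
  coordinates only. Such a cutoff is constant on fibres, hence of weight 0, so the product keeps the
  weight of the coordinate, and it equals the coordinate on one entire fibre. That is enough:
  \<open>X\<close> has no base components, so the value of \<open>X f\<close> at a point depends
  only on \<open>f\<close> along the fibre through it, and integral curves stay in one fibre. In the
  coordinates of a trivialization a fibre is a whole vector space, so such a curve never leaves the
  chart and the coefficients of \<open>X\<close> are constants along it. Existence and uniqueness of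
  the flow thereby become an elementary system of equations over a frozen base point. The
  coefficients are given chart by chart, without transformation laws. Local formulas are compared
  through the flow, which refers to no chart.\<close>

lemma Ck_on_cong:
  assumes "open S" "\<And>x. x \<in> S \<Longrightarrow> f x = g x" "Ck_on k S f"
  shows "Ck_on k S g"
  using assms(2,3)
proof (induction k arbitrary: f g)
  case 0
  then show ?case by (simp cong: continuous_on_cong)
next
  case (Suc k)
  have d: "f differentiable (at x)" if "x \<in> S" for x using Suc.prems that by simp
  have eq: "frechet_derivative f (at x) = frechet_derivative g (at x)" if "x \<in> S" for x
    using frechet_derivative_transform_within_open[OF d[OF that] assms(1) that Suc.prems(1)] .
  have "g differentiable (at x)" if "x \<in> S" for x
    using d[OF that] has_derivative_transform_within_open[OF _ assms(1) that, of f _ UNIV g]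
      Suc.prems(1)
    unfolding differentiable_def by blast
  moreover have "Ck_on k S (\<lambda>x. frechet_derivative g (at x) v)" for v
    by (rule Suc.IH[of "\<lambda>x. frechet_derivative f (at x) v"]) (use Suc.prems eq in auto)
  ultimately show ?case by simp
qed

lemma Ck_on_SucI:
  assumes "open S" "\<And>x. x \<in> S \<Longrightarrow> (f has_derivative D x) (at x)"
    "\<And>v. Ck_on k S (\<lambda>x. D x v)"
  shows "Ck_on (Suc k) S f"
proof -
  have "frechet_derivative f (at x) = D x" if "x \<in> S" for x
    using frechet_derivative_at[OF assms(2)[OF that]] by simp
  then have "Ck_on k S (\<lambda>x. frechet_derivative f (at x) v)" for v
    using Ck_on_cong[OF assms(1) _ assms(3)[of v]] by auto
  then show ?thesis using assms(2) by (auto simp: differentiable_def)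
qed

text \<open>The successor clause does not mention continuity of \<open>f\<close> itself; it is
  recovered from differentiability at the bottom of the recursion.\<close>

lemma Ck_on_SucD: "Ck_on (Suc k) S f \<Longrightarrow> Ck_on k S f"
proof (induction k arbitrary: f)
  case 0
  then show ?case
    using differentiable_imp_continuous_on differentiable_at_withinI
    by (fastforce simp: differentiable_on_def)
next
  case (Suc k)
  then show ?case by auto
qed

lemma Ck_on_subset: "Ck_on k S f \<Longrightarrow> T \<subseteq> S \<Longrightarrow> Ck_on k T f"
  by (induction k arbitrary: f) (auto intro: continuous_on_subset)

text \<open>Meant for functions that are defined by cases and extended by zero: each point may use a
  different neighbourhood and a different formula.\<close>

lemma Ck_on_local:
  assumes "\<And>x. x \<in> S \<Longrightarrow> \<exists>N. open N \<and> x \<in> N \<and> Ck_on k N f"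
  shows "Ck_on k S f"
  using assms
proof (induction k arbitrary: f)
  case 0
  have "continuous (at x within S) f" if "x \<in> S" for x
  proof -
    obtain N where "open N" "x \<in> N" "continuous_on N f" using 0 \<open>x \<in> S\<close> by auto
    then show ?thesis
      by (simp add: continuous_at_imp_continuous_within continuous_on_eq_continuous_at)
  qed
  then show ?case by (simp add: continuous_on_eq_continuous_within)
next
  case (Suc k)
  have "f differentiable at x" if "x \<in> S" for x using Suc.prems[OF that] by auto
  moreover have "Ck_on k S (\<lambda>x. frechet_derivative f (at x) v)" for v
    by (rule Suc.IH) (use Suc.prems in force)
  ultimately show ?case by simp
qed

lemma Ck_on_const: "open S \<Longrightarrow> Ck_on k S (\<lambda>_. c)"
proof (induction k arbitrary: c)
  case (Suc k)
  show ?case by (rule Ck_on_SucI[where D="\<lambda>_ _. 0"]) (use Suc in auto)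
qed auto

lemma Ck_on_bounded_linear:
  assumes "open S" "bounded_linear L"
  shows "Ck_on k S L"
proof (cases k)
  case 0
  then show ?thesis using assms(2) linear_continuous_on by auto
next
  case (Suc m)
  show ?thesis unfolding Suc
    by (rule Ck_on_SucI[where D="\<lambda>_. L"])
      (use assms Ck_on_const bounded_linear_imp_has_derivative in auto)
qed

lemma Ck_on_add:
  assumes "open S" "Ck_on k S f" "Ck_on k S g"
  shows "Ck_on k S (\<lambda>x. f x + g x)"
  using assms(2,3)
proof (induction k arbitrary: f g)
  case (Suc k)
  show ?case
    by (rule Ck_on_SucI[OF assms(1),
          where D="\<lambda>x v. frechet_derivative f (at x) v + frechet_derivative g (at x) v"])
      (use Suc in \<open>auto intro!: has_derivative_add simp: frechet_derivative_works[symmetric]\<close>)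
qed (auto intro: continuous_intros)

lemma Ck_on_sum:
  assumes "open S" "\<And>i. i \<in> A \<Longrightarrow> Ck_on k S (f i)"
  shows "Ck_on k S (\<lambda>x. \<Sum>i\<in>A. f i x)"
  using assms(2)
  by (induction A rule: infinite_finite_induct)
    (auto intro: Ck_on_const Ck_on_add assms(1))

lemma Ck_on_bounded_bilinear:
  assumes "bounded_bilinear pr" "open S" "Ck_on k S f" "Ck_on k S g"
  shows "Ck_on k S (\<lambda>x. pr (f x) (g x))"
  using assms(3,4)
proof (induction k arbitrary: f g)
  case 0
  then show ?case using bounded_bilinear.continuous_on[OF assms(1)] by auto
next
  case (Suc k)
  have "Ck_on k S f" "Ck_on k S g" using Suc.prems[THEN Ck_on_SucD] by auto
  then have "Ck_on k S (\<lambda>x. pr (f x) (frechet_derivative g (at x) v)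
        + pr (frechet_derivative f (at x) v) (g x))" for v
    using Suc by (auto intro!: Ck_on_add assms(2))
  then show ?case
    using Suc.prems
    by (intro Ck_on_SucI[OF assms(2), where D="\<lambda>x v. pr (f x) (frechet_derivative g (at x) v)
        + pr (frechet_derivative f (at x) v) (g x)"])
       (auto intro!: bounded_bilinear.FDERIV[OF assms(1)] simp: frechet_derivative_works[symmetric])
qed

text \<open>The definition controls derivatives only in a fixed direction \<open>v\<close>, whereas
  the chain rule differentiates \<open>g\<close> in the moving direction
  \<open>frechet_derivative f (at x) v\<close>. Expanding that direction in a basis leaves
  directional derivatives of \<open>g\<close> along fixed vectors, to which the induction hypothesis
  applies; hence the Euclidean intermediate space.\<close>

lemma Ck_on_compose:
  fixes f :: "'a::real_normed_vector \<Rightarrow> 'b::euclidean_space"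
  assumes "open S" "open T" "f ` S \<subseteq> T" "Ck_on k S f" "Ck_on k T g"
  shows "Ck_on k S (\<lambda>x. g (f x))"
  using assms(4,5)
proof (induction k arbitrary: g)
  case 0
  then show ?case using assms(3) continuous_on_compose2 by auto
next
  case (Suc k)
  let ?D = "\<lambda>x v. frechet_derivative g (at (f x)) (frechet_derivative f (at x) v)"
  have f: "(f has_derivative frechet_derivative f (at x)) (at x)" if "x \<in> S" for x
    using Suc.prems that by (simp add: frechet_derivative_works[symmetric])
  have g: "(g has_derivative frechet_derivative g (at (f x))) (at (f x))" if "x \<in> S" for x
    using Suc.prems that assms(3) by (auto simp add: frechet_derivative_works[symmetric])
  have eq: "(\<Sum>b\<in>Basis. (frechet_derivative f (at x) v \<bullet> b) *\<^sub>R frechet_derivative g (at (f x)) b)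
      = ?D x v" if "x \<in> S" for x v
  proof -
    have lin: "linear (frechet_derivative g (at (f x)))"
      using g[OF that] has_derivative_linear by blast
    have "?D x v = frechet_derivative g (at (f x))
        (\<Sum>b\<in>Basis. (frechet_derivative f (at x) v \<bullet> b) *\<^sub>R b)"
      by (simp add: euclidean_representation)
    then show ?thesis by (simp add: linear_sum[OF lin] linear_scale[OF lin])
  qed
  have "Ck_on k S (\<lambda>x. frechet_derivative f (at x) v \<bullet> b)" for v b
    using Suc.prems
    by (intro Ck_on_bounded_bilinear[OF bounded_bilinear_inner] Ck_on_const assms(1)) auto
  moreover have "Ck_on k S (\<lambda>x. frechet_derivative g (at (f x)) b)" for b
    by (intro Suc.IH Ck_on_SucD[OF Suc.prems(1)]) (use Suc.prems in simp)
  ultimately have "Ck_on k S (\<lambda>x. \<Sum>b\<in>Basis.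
      (frechet_derivative f (at x) v \<bullet> b) *\<^sub>R frechet_derivative g (at (f x)) b)" for v
    by (intro Ck_on_sum Ck_on_bounded_bilinear[OF bounded_bilinear_scaleR] assms(1)) auto
  then have "Ck_on k S (\<lambda>x. ?D x v)" for v
    by (rule Ck_on_cong[OF assms(1) eq, rotated])
  then show ?case
    by (rule Ck_on_SucI[OF assms(1), rotated])
      (use diff_chain_at[OF f g] in \<open>auto simp: o_def\<close>)
qed

lemma smooth_on_cong:
  "open S \<Longrightarrow> (\<And>x. x \<in> S \<Longrightarrow> f x = g x) \<Longrightarrow> smooth_on S f \<Longrightarrow> smooth_on S g"
  using Ck_on_cong unfolding smooth_on_def by blast

lemma smooth_on_subset: "smooth_on S f \<Longrightarrow> T \<subseteq> S \<Longrightarrow> smooth_on T f"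
  using Ck_on_subset unfolding smooth_on_def by blast

lemma smooth_on_local:
  assumes "\<And>x. x \<in> S \<Longrightarrow> \<exists>N. open N \<and> x \<in> N \<and> smooth_on N f"
  shows "smooth_on S f"
  using Ck_on_local assms unfolding smooth_on_def by metis

lemma smooth_on_const [simp]: "open S \<Longrightarrow> smooth_on S (\<lambda>_. c)"
  by (simp add: smooth_on_def Ck_on_const)

lemma smooth_on_bounded_linear: "open S \<Longrightarrow> bounded_linear L \<Longrightarrow> smooth_on S L"
  by (simp add: smooth_on_def Ck_on_bounded_linear)

lemma smooth_on_add:
  "open S \<Longrightarrow> smooth_on S f \<Longrightarrow> smooth_on S g \<Longrightarrow> smooth_on S (\<lambda>x. f x + g x)"
  by (simp add: smooth_on_def Ck_on_add)

lemma smooth_on_sum: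
  "open S \<Longrightarrow> (\<And>i. i \<in> A \<Longrightarrow> smooth_on S (f i)) \<Longrightarrow> smooth_on S (\<lambda>x. \<Sum>i\<in>A. f i x)"
  by (simp add: smooth_on_def Ck_on_sum)

lemma smooth_on_scaleR:
  "open S \<Longrightarrow> smooth_on S f \<Longrightarrow> smooth_on S g \<Longrightarrow> smooth_on S (\<lambda>x. f x *\<^sub>R g x)"
  by (simp add: smooth_on_def Ck_on_bounded_bilinear[OF bounded_bilinear_scaleR])

lemma smooth_on_mult:
  fixes f g :: "_ \<Rightarrow> real"
  shows "open S \<Longrightarrow> smooth_on S f \<Longrightarrow> smooth_on S g \<Longrightarrow> smooth_on S (\<lambda>x. f x * g x)"
  by (simp add: smooth_on_def Ck_on_bounded_bilinear[OF bounded_bilinear_mult])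

lemma smooth_on_diff:
  fixes f g :: "_ \<Rightarrow> real"
  assumes "open S" "smooth_on S f" "smooth_on S g"
  shows "smooth_on S (\<lambda>x. f x - g x)"
proof -
  have "smooth_on S (\<lambda>x. (-1) * g x)" using assms by (intro smooth_on_mult) auto
  from smooth_on_add[OF assms(1,2) this] show ?thesis by simp
qed

lemma smooth_on_ident: "open S \<Longrightarrow> smooth_on S (\<lambda>x. x)"
  by (simp add: smooth_on_bounded_linear bounded_linear_ident)

lemma smooth_on_divide_const:
  fixes f :: "_ \<Rightarrow> real"
  assumes "open S" "smooth_on S f"
  shows "smooth_on S (\<lambda>x. f x / c)"
  using smooth_on_mult[OF assms smooth_on_const[OF assms(1), of "1 / c"]] by simp

lemma smooth_on_power:
  fixes f :: "_ \<Rightarrow> real"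
  shows "open S \<Longrightarrow> smooth_on S f \<Longrightarrow> smooth_on S (\<lambda>x. f x ^ n)"
  by (induction n) (auto intro: smooth_on_mult)

lemma smooth_on_compose:
  fixes f :: "'a::real_normed_vector \<Rightarrow> 'b::euclidean_space"
  shows "open S \<Longrightarrow> open T \<Longrightarrow> f ` S \<subseteq> T \<Longrightarrow> smooth_on S f \<Longrightarrow> smooth_on T g
    \<Longrightarrow> smooth_on S (\<lambda>x. g (f x))"
  by (simp add: smooth_on_def Ck_on_compose)

lemma smooth_on_vec:
  fixes f :: "_ \<Rightarrow> real ^ 'i"
  assumes "open S" "\<And>i. smooth_on S (\<lambda>x. f x $ i)"
  shows "smooth_on S f"
proof -
  have "f = (\<lambda>x. \<Sum>i\<in>UNIV. f x $ i *\<^sub>R axis i 1)"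
    by (auto simp: vec_eq_iff axis_def if_distrib cong: if_cong)
  moreover have "smooth_on S (\<lambda>x. \<Sum>i\<in>UNIV. f x $ i *\<^sub>R (axis i 1 :: real ^ 'i))"
    using assms by (intro smooth_on_sum smooth_on_scaleR smooth_on_const) auto
  ultimately show ?thesis by simp
qed

lemma smooth_on_continuous: "smooth_on S f \<Longrightarrow> continuous_on S f"
  unfolding smooth_on_def by (metis Ck_on.simps(1))

lemma smooth_on_differentiable: "smooth_on S f \<Longrightarrow> x \<in> S \<Longrightarrow> f differentiable at x"
  unfolding smooth_on_def using Ck_on.simps(2) by blast

lemma smooth_on_frechet_derivative:
  "smooth_on S f \<Longrightarrow> smooth_on S (\<lambda>x. frechet_derivative f (at x) v)"
  unfolding smooth_on_def using Ck_on.simps(2) by blast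

text \<open>The chain rule along a line of jets with fixed first component. It is used with
  \<open>c\<close> equal to 1 and to the square of \<open>a\<close>, the two sides of the scaling
  identity for \<open>X \<circ> X\<close>.\<close>

lemma has_real_derivative_snd_line:
  fixes \<phi> :: "real \<times> real \<Rightarrow> real"
  assumes "smooth_on UNIV \<phi>"
  shows "((\<lambda>t. \<phi> (a, c * t)) has_real_derivative
    c * frechet_derivative \<phi> (at (a, c * t)) (0, 1)) (at t)"
proof -
  let ?D = "frechet_derivative \<phi> (at (a, c * t))"
  have d: "(\<phi> has_derivative ?D) (at (a, c * t))"
    using smooth_on_differentiable[OF assms] by (simp add: frechet_derivative_works)
  have "((\<lambda>t. (a, c * t)) has_derivative (\<lambda>h. (0, c * h))) (at t)"
    by (auto intro!: derivative_eq_intros)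
  from diff_chain_at[OF this d]
  have "((\<lambda>t. \<phi> (a, c * t)) has_derivative (\<lambda>h. ?D (0, c * h))) (at t)"
    by (simp add: o_def)
  moreover have "?D (0, c * h) = c * ?D (0, 1) * h" for h
    using linear_scale[OF has_derivative_linear[OF d], of "c * h" "(0, 1)"] by simp
  ultimately show ?thesis by (simp add: has_field_derivative_def)
qed

section \<open>A smooth function that is flat at zero\<close>

definition flat_exp :: "nat \<Rightarrow> real \<Rightarrow> real" where
  "flat_exp n s = (if s > 0 then exp (- 1 / s) / s ^ n else 0)"

lemma flat_exp_tendsto: "(flat_exp n \<longlongrightarrow> 0) (at 0)"
proof -
  have "((\<lambda>s::real. exp (- 1 / s) / s ^ n) \<longlongrightarrow> 0) (at_right 0)"
  proof -
    have "((\<lambda>y::real. y ^ n / exp y) \<longlongrightarrow> 0) at_top" by (rule tendsto_power_div_exp_0)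
    then have "((\<lambda>s::real. inverse s ^ n / exp (inverse s)) \<longlongrightarrow> 0) (at_right 0)"
      using filterlim_compose filterlim_inverse_at_top_right by blast
    then show ?thesis by (simp add: field_simps exp_minus)
  qed
  then have "(flat_exp n \<longlongrightarrow> 0) (at_right 0)"
    by (rule Lim_transform_eventually) (auto simp: eventually_at_filter flat_exp_def)
  moreover have "(flat_exp n \<longlongrightarrow> 0) (at_left 0)"
    by (rule Lim_transform_eventually[OF tendsto_const])
      (auto simp: eventually_at_filter flat_exp_def)
  ultimately show ?thesis using filterlim_split_at by blast
qed

lemma flat_exp_deriv:
  "(flat_exp n has_real_derivative (flat_exp (n + 2) s - real n * flat_exp (n + 1) s)) (at s)"
proof -
  consider "s > 0" | "s < 0" | "s = 0" by linarith
  then show ?thesis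
  proof cases
    case 1
    have "((\<lambda>s. exp (- 1 / s) / s ^ n) has_real_derivative
        (flat_exp (n + 2) s - real n * flat_exp (n + 1) s)) (at s)"
    proof -
      have d: "((\<lambda>s. exp (- 1 / s)) has_real_derivative exp (- 1 / s) / s\<^sup>2) (at s)"
        using 1 by (auto intro!: derivative_eq_intros simp: power2_eq_square)
      have e: "((\<lambda>s. s ^ n) has_real_derivative real n * s ^ n / s) (at s)"
        using 1 DERIV_pow[of n s UNIV] by (cases n) auto
      have "s ^ n \<noteq> 0" using 1 by simp
      show ?thesis
        by (rule DERIV_cong[OF DERIV_divide[OF d e \<open>s ^ n \<noteq> 0\<close>]])
          (use 1 in \<open>simp add: flat_exp_def divide_simps\<close>,
            use 1 in \<open>simp add: algebra_simps power2_eq_square\<close>)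
    qed
    then show ?thesis
      by (rule has_field_derivative_transform_within_open[of _ _ _ "{0<..}"])
        (use 1 in \<open>auto simp: flat_exp_def\<close>)
  next
    case 2
    have "((\<lambda>_. 0) has_real_derivative 0) (at s)" by simp
    then show ?thesis
      using 2 has_field_derivative_transform_within_open[of "\<lambda>_. 0" 0 s "{..<0}" "flat_exp n"]
      by (auto simp: flat_exp_def)
  next
    case 3
    \<comment> \<open>The difference quotient of \<open>flat_exp n\<close> at 0 is
      \<open>flat_exp (Suc n)\<close>, whose limit is known.\<close>
    have "((\<lambda>h. (flat_exp n (0 + h) - flat_exp n 0) / h) \<longlongrightarrow> 0) (at 0)"
      by (rule Lim_transform_eventually[OF flat_exp_tendsto[of "Suc n"]])
        (auto simp: flat_exp_def eventually_at_filter)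
    then show ?thesis unfolding 3 by (simp add: DERIV_def flat_exp_def)
  qed
qed

text \<open>Only \<open>n = 0\<close> enters the cutoff. The other exponents are there because the
  family is closed under differentiation up to linear combinations, so the induction on the order
  runs for all \<open>n\<close> at once.\<close>

lemma smooth_on_flat_exp: "smooth_on UNIV (flat_exp n)"
proof -
  have "Ck_on k UNIV (flat_exp n)" for k
  proof (induction k arbitrary: n)
    case 0
    then show ?case using flat_exp_deriv DERIV_isCont by (fastforce simp: continuous_on_eq_continuous_at)
  next
    case (Suc k)
    let ?D = "\<lambda>s v. (flat_exp (n + 2) s + (- real n) * flat_exp (n + 1) s) * v"
    have "Ck_on k UNIV (\<lambda>s. ?D s v)" for v
      using Suc
      by (intro Ck_on_bounded_bilinear[OF bounded_bilinear_mult] Ck_on_add Ck_on_const) auto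
    then show ?case
      using flat_exp_deriv[of n]
      by (intro Ck_on_SucI[where D="?D"]) (auto simp: has_field_derivative_def)
  qed
  then show ?thesis by (simp add: smooth_on_def)
qed

section \<open>Charts of a graded bundle\<close>

lemma linear_restr: "linear (restr J)"
  by (rule linearI) (auto simp: restr_def vec_eq_iff)

lemma bounded_linear_restr: "bounded_linear (restr J)"
  using linear_restr linear_conv_bounded_linear by blast

lemma restr_in_coord_space [simp]: "restr J v \<in> coord_space J"
  by (simp add: restr_def coord_space_def)

lemma restr_id: "v \<in> coord_space J \<Longrightarrow> restr J v = v"
  by (auto simp: restr_def coord_space_def vec_eq_iff)

text \<open>Makes the intersection of a closed ball with the coordinate space compact, as the
  support of the cutoff requires.\<close>

lemma closed_coord_space: "closed (coord_space J)"
proof -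
  have "coord_space J = {v. restr J v = id v}"
    using restr_id restr_in_coord_space by (metis (mono_tags) Collect_cong Collect_mem_eq id_apply)
  then show ?thesis
    using closed_Collect_eq[of "restr J" id] linear_continuous_on[OF bounded_linear_restr]
    by auto
qed

context
  fixes J :: "'i::finite set" and c :: "('x::topological_space, 'i) chart"
  assumes chart: "is_chart J c"
begin

lemma chart_open: "open (fst c)"
  using chart unfolding is_chart_def by (elim conjE)

lemma chart_inj: "inj_on (snd c) (fst c)"
  using chart unfolding is_chart_def homeomorphism_def by (metis inj_on_inverseI)

lemma chart_range: "p \<in> fst c \<Longrightarrow> snd c p \<in> coord_space J"
  using chart openin_imp_subset unfolding is_chart_def by blast

lemma chart_param_dom:
  assumes "v \<in> chart_dom J c"
  shows "chart_param J c v \<in> fst c" "snd c (chart_param J c v) = restr J v"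
  using assms unfolding chart_dom_def chart_param_def
  by (auto intro: inv_into_into f_inv_into_f)

lemma chart_param_inv:
  assumes "p \<in> fst c"
  shows "snd c p \<in> chart_dom J c" "chart_param J c (snd c p) = p"
  using assms restr_id[OF chart_range[OF assms]] inv_into_f_f[OF chart_inj assms]
  unfolding chart_dom_def chart_param_def by auto

lemma chart_param_eqI:
  assumes "p \<in> fst c" "restr J v = snd c p"
  shows "chart_param J c v = p" "v \<in> chart_dom J c"
  using assms inv_into_f_f[OF chart_inj assms(1)]
  unfolding chart_dom_def chart_param_def by auto

lemma open_chart_dom: "open (chart_dom J c)"
proof -
  obtain W where W: "open W" "snd c ` fst c = coord_space J \<inter> W"
    using chart unfolding is_chart_def openin_open by blast
  have "chart_dom J c = restr J -` W" unfolding chart_dom_def W(2) by auto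
  then show ?thesis
    using open_vimage[OF W(1) linear_continuous_on[OF bounded_linear_restr]] by simp
qed

lemma continuous_on_chart_param: "continuous_on (chart_dom J c) (chart_param J c)"
proof -
  obtain g where g: "homeomorphism (fst c) (snd c ` fst c) (snd c) g"
    using chart unfolding is_chart_def by blast
  have eq: "chart_param J c v = g (restr J v)" if "v \<in> chart_dom J c" for v
    using that g chart_param_dom[OF that] by (metis homeomorphism_apply1)
  have "continuous_on (chart_dom J c) (\<lambda>v. g (restr J v))"
    by (rule continuous_on_compose2[OF homeomorphism_cont2[OF g]])
      (auto simp: chart_dom_def intro: linear_continuous_on bounded_linear_restr)
  then show ?thesis using eq by (simp cong: continuous_on_cong)
qed

lemma continuous_on_chart: "continuous_on (fst c) (snd c)"
  using chart homeomorphism_cont1 unfolding is_chart_def by blast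

lemma open_chart_param_vimage: "open U \<Longrightarrow> open {v \<in> chart_dom J c. chart_param J c v \<in> U}"
  using continuous_open_preimage[OF continuous_on_chart_param open_chart_dom]
  by (simp add: Int_def vimage_def)

lemma openin_chart_image:
  assumes "open U" "U \<subseteq> fst c"
  shows "openin (top_of_set (coord_space J)) (snd c ` U)"
proof -
  obtain g where "homeomorphism (fst c) (snd c ` fst c) (snd c) g"
    using chart unfolding is_chart_def by blast
  moreover have "openin (top_of_set (fst c)) U" using assms by (simp add: open_subset)
  ultimately have "openin (top_of_set (snd c ` fst c)) (snd c ` U)"
    using homeomorphism_imp_open_map by blast
  then show ?thesis using chart openin_trans unfolding is_chart_def by blast
qed

end

text \<open>Each monomial of weight \<open>k\<close> picks up exactly the factor
  \<open>t ^ k\<close>. This is what makes homotheties independent of the trivialization.\<close>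

lemma weighted_poly_scale:
  assumes "weighted_poly K w k P" "\<And>i. i \<in> K \<Longrightarrow> u $ i = t ^ w i * v $ i"
  shows "P u = t ^ k * P v"
proof -
  obtain E a where E: "\<forall>m\<in>E. (\<Sum>i\<in>K. m i * w i) = k"
    and P: "\<And>v. P v = (\<Sum>m\<in>E. a m * (\<Prod>i\<in>K. (v $ i) ^ m i))"
    using assms(1) unfolding weighted_poly_def by blast
  have "(\<Prod>i\<in>K. (u $ i) ^ m i) = t ^ k * (\<Prod>i\<in>K. (v $ i) ^ m i)" if "m \<in> E" for m
  proof -
    have "(\<Prod>i\<in>K. (u $ i) ^ m i) = (\<Prod>i\<in>K. t ^ (m i * w i) * (v $ i) ^ m i)"
      using assms(2)
      by (intro prod.cong) (auto simp: power_mult_distrib power_mult[symmetric] mult.commute)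
    also have "\<dots> = t ^ (\<Sum>i\<in>K. m i * w i) * (\<Prod>i\<in>K. (v $ i) ^ m i)"
      by (simp add: prod.distrib power_sum)
    finally show ?thesis using E that by simp
  qed
  then show ?thesis unfolding P by (simp add: sum_distrib_left algebra_simps)
qed

locale graded_bundle_manifold =
  fixes M :: "('m::{t2_space, second_countable_topology},
               'b::{t2_space, second_countable_topology}, 'i::finite) fibre_bundle"
  assumes graded: "graded_bundle M"
begin

abbreviation "cdom b T \<equiv> chart_dom (idx M) (graded_chart M b T)"
abbreviation "param b T \<equiv> chart_param (idx M) (graded_chart M b T)"
abbreviation "coord b T \<equiv> snd (graded_chart M b T)"
abbreviation "J0 \<equiv> idx_of M 0"
abbreviation "JF \<equiv> fib_idx M"

lemma base_chart: "b \<in> base_atlas M \<Longrightarrow> is_chart J0 b"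
  using graded unfolding graded_bundle_def smooth_atlas_def by blast

lemma total_chart:
  "b \<in> base_atlas M \<Longrightarrow> T \<in> trivs M \<Longrightarrow> is_chart (idx M) (graded_chart M b T)"
  using graded unfolding graded_bundle_def smooth_atlas_def total_atlas_def by blast

lemma mem_chart: "p \<in> fst (graded_chart M b T) \<longleftrightarrow> bproj M p \<in> fst b \<and> bproj M p \<in> fst T"
  by (simp add: graded_chart_def)

lemma transition_smooth:
  assumes "b \<in> base_atlas M" "T \<in> trivs M" "b' \<in> base_atlas M" "T' \<in> trivs M"
  shows "smooth_on {v \<in> cdom b T. param b T v \<in> fst (graded_chart M b' T')}
    (\<lambda>v. coord b' T' (param b T v))"
  using graded assms unfolding graded_bundle_def smooth_atlas_def total_atlas_def by blast

lemma open_transition_domain: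
  assumes "b \<in> base_atlas M" "T \<in> trivs M" "b' \<in> base_atlas M" "T' \<in> trivs M"
  shows "open {v \<in> cdom b T. param b T v \<in> fst (graded_chart M b' T')}"
  by (rule open_chart_param_vimage[OF total_chart[OF assms(1,2)]
        chart_open[OF total_chart[OF assms(3,4)]]])

lemma triv_homeo:
  assumes "T \<in> trivs M"
  obtains g where "open (fst T)" "homeomorphism (bproj M -` fst T) (fst T \<times> coord_space JF)
               (\<lambda>p. (bproj M p, snd T p)) g"
proof -
  have "\<forall>T\<in>trivs M. open (fst T) \<and>
        (\<exists>g. homeomorphism (bproj M -` fst T) (fst T \<times> coord_space JF)
               (\<lambda>p. (bproj M p, snd T p)) g)"
    using graded unfolding graded_bundle_def by (elim conjE)
  from bspec[OF this assms] show ?thesis by (elim conjE exE) (rule that)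
qed

lemma triv_transition:
  assumes "T \<in> trivs M" "T' \<in> trivs M" "x \<in> fst T" "x \<in> fst T'" "i \<in> JF"
  obtains P where "weighted_poly JF (wt M) (wt M i) P"
    "\<And>p. bproj M p = x \<Longrightarrow> snd T' p $ i = P (snd T p)"
proof -
  have "\<forall>T\<in>trivs M. \<forall>T'\<in>trivs M. \<forall>x \<in> fst T \<inter> fst T'. \<forall>i\<in>JF.
        \<exists>P. weighted_poly JF (wt M) (wt M i) P \<and>
            (\<forall>p. bproj M p = x \<longrightarrow> snd T' p $ i = P (snd T p))"
    using graded unfolding graded_bundle_def by (elim conjE)
  from this[rule_format, of T T' x i] assms that show ?thesis by auto
qed

lemma triv_range:
  assumes "T \<in> trivs M" "bproj M p \<in> fst T"
  shows "snd T p \<in> coord_space JF"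
proof -
  obtain g where "homeomorphism (bproj M -` fst T) (fst T \<times> coord_space JF)
               (\<lambda>p. (bproj M p, snd T p)) g" by (rule triv_homeo[OF assms(1)])
  then have "(\<lambda>p. (bproj M p, snd T p)) ` (bproj M -` fst T) = fst T \<times> coord_space JF"
    by (rule homeomorphism_image1)
  moreover have "(bproj M p, snd T p) \<in> (\<lambda>p. (bproj M p, snd T p)) ` (bproj M -` fst T)"
    using assms(2) by (intro imageI) simp
  ultimately show ?thesis by simp
qed

lemma triv_inj:
  assumes "T \<in> trivs M" "bproj M p \<in> fst T" "bproj M q = bproj M p" "snd T q = snd T p"
  shows "q = p"
proof -
  obtain g where "homeomorphism (bproj M -` fst T) (fst T \<times> coord_space JF)
               (\<lambda>p. (bproj M p, snd T p)) g" by (rule triv_homeo[OF assms(1)])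
  then have "g (bproj M r, snd T r) = r" if "bproj M r \<in> fst T" for r
    using homeomorphism_apply1 that by fastforce
  then show ?thesis using assms by metis
qed

lemma triv_surj:
  assumes "T \<in> trivs M" "x \<in> fst T" "y \<in> coord_space JF"
  obtains p where "bproj M p = x" "snd T p = y"
proof -
  obtain g where "homeomorphism (bproj M -` fst T) (fst T \<times> coord_space JF)
               (\<lambda>p. (bproj M p, snd T p)) g" by (rule triv_homeo[OF assms(1)])
  then have "(\<lambda>p. (bproj M p, snd T p)) ` (bproj M -` fst T) = fst T \<times> coord_space JF"
    by (rule homeomorphism_image1)
  then have "(x, y) \<in> (\<lambda>p. (bproj M p, snd T p)) ` (bproj M -` fst T)"
    using assms by simp
  then obtain p where "(x, y) = (bproj M p, snd T p)" by (elim imageE)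
  then show ?thesis using that[of p] by simp
qed

lemma base_cover:
  obtains b T where "b \<in> base_atlas M" "T \<in> trivs M" "x \<in> fst b" "x \<in> fst T"
proof -
  have "x \<in> (\<Union>b\<in>base_atlas M. fst b)" "x \<in> (\<Union>T\<in>trivs M. fst T)"
    using graded unfolding graded_bundle_def smooth_atlas_def by simp_all
  then obtain b T where "b \<in> base_atlas M" "x \<in> fst b" "T \<in> trivs M" "x \<in> fst T"
    by (elim UN_E)
  then show ?thesis by (intro that)
qed

text \<open>Continuity of the projection is not part of the bundle data. It is read off from the
  first component of the trivializing homeomorphisms, on sets that are open because they are domains
  of total charts.\<close>

lemma continuous_bproj: "continuous_on UNIV (bproj M)"
proof -
  have "\<exists>A. p \<in> A \<and> open A \<and> continuous_on A (bproj M)" for p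
  proof -
    obtain b T where bT: "b \<in> base_atlas M" "T \<in> trivs M" "bproj M p \<in> fst b" "bproj M p \<in> fst T"
      by (rule base_cover)
    obtain g where g: "homeomorphism (bproj M -` fst T) (fst T \<times> coord_space JF)
               (\<lambda>p. (bproj M p, snd T p)) g" by (rule triv_homeo[OF bT(2)])
    have "continuous_on (bproj M -` fst T) (\<lambda>p. fst (bproj M p, snd T p))"
      using homeomorphism_cont1[OF g] continuous_on_fst by blast
    then have "continuous_on (fst (graded_chart M b T)) (bproj M)"
      unfolding fst_conv by (rule continuous_on_subset) (auto simp: graded_chart_def)
    then show ?thesis
      using bT chart_open[OF total_chart[OF bT(1,2)]] mem_chart[of p b T] by blast
  qed
  then have "isCont (bproj M) p" for p
    using continuous_on_eq_continuous_at by metis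
  then show ?thesis by (simp add: continuous_at_imp_continuous_on)
qed

lemma idx_cases:
  obtains "i \<in> J0" "i \<notin> JF" "i \<in> idx M" | "i \<in> JF" "i \<notin> J0" "i \<in> idx M"
  | "i \<notin> idx M" "i \<notin> J0" "i \<notin> JF"
  by (auto simp: idx_of_def fib_idx_def)

context
  fixes b T
  assumes bT: "b \<in> base_atlas M" "T \<in> trivs M"
begin

lemma coord_nth:
  assumes "bproj M p \<in> fst b" "bproj M p \<in> fst T"
  shows "i \<in> JF \<Longrightarrow> coord b T p $ i = snd T p $ i"
    "i \<notin> JF \<Longrightarrow> coord b T p $ i = snd b (bproj M p) $ i"
    "i \<notin> idx M \<Longrightarrow> coord b T p $ i = 0"
    "restr J0 (coord b T p) = snd b (bproj M p)"
proof -
  have 1: "snd T p \<in> coord_space JF" using triv_range bT assms by blast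
  have 2: "snd b (bproj M p) \<in> coord_space J0" using chart_range base_chart bT assms by blast
  show "i \<in> JF \<Longrightarrow> coord b T p $ i = snd T p $ i"
    "i \<notin> JF \<Longrightarrow> coord b T p $ i = snd b (bproj M p) $ i"
    "i \<notin> idx M \<Longrightarrow> coord b T p $ i = 0"
    using 1 2 by (cases i rule: idx_cases; simp add: graded_chart_def coord_space_def)+
  show "restr J0 (coord b T p) = snd b (bproj M p)"
    unfolding vec_eq_iff
  proof
    fix i show "restr J0 (coord b T p) $ i = snd b (bproj M p) $ i"
      using 1 2 by (cases i rule: idx_cases) (simp_all add: restr_def graded_chart_def coord_space_def)
  qed
qed

text \<open>A trivialization maps each fibre onto the whole of \<open>coord_space JF\<close>, so the
  fibre components of a point may be replaced arbitrarily without leaving the chart. This is why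
  explicit curves in coordinates are defined for all times.\<close>

lemma param_shift:
  assumes "bproj M p \<in> fst b" "bproj M p \<in> fst T" "\<And>i. i \<notin> JF \<Longrightarrow> v $ i = coord b T p $ i"
  shows "v \<in> cdom b T" "bproj M (param b T v) = bproj M p" "coord b T (param b T v) = v"
proof -
  obtain q where q: "bproj M q = bproj M p" "snd T q = restr JF v"
    using triv_surj[OF bT(2) assms(2) restr_in_coord_space] by blast
  have v: "coord b T q = v"
    unfolding vec_eq_iff
  proof
    fix i
    show "coord b T q $ i = v $ i"
      using assms coord_nth(1,2)[of q i] coord_nth(1,2)[of p i] q
      by (cases "i \<in> JF") (auto simp: restr_def)
  qed
  have mem: "q \<in> fst (graded_chart M b T)" using q assms by (simp add: mem_chart)
  have "param b T v = q" "v \<in> cdom b T"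
    using chart_param_inv[OF total_chart[OF bT] mem] v by auto
  then show "v \<in> cdom b T" "bproj M (param b T v) = bproj M p" "coord b T (param b T v) = v"
    using q v by auto
qed

lemma bproj_param:
  assumes "v \<in> cdom b T"
  shows "bproj M (param b T v) \<in> fst b" "bproj M (param b T v) \<in> fst T"
    "v \<in> chart_dom J0 b" "bproj M (param b T v) = chart_param J0 b v"
proof -
  show 1: "bproj M (param b T v) \<in> fst b" "bproj M (param b T v) \<in> fst T"
    using chart_param_dom[OF total_chart[OF bT] assms] by (auto simp: mem_chart)
  have "restr J0 v = restr J0 (restr (idx M) v)"
    by (auto simp: restr_def idx_of_def vec_eq_iff)
  also have "\<dots> = snd b (bproj M (param b T v))"
    using coord_nth(4)[OF 1] chart_param_dom(2)[OF total_chart[OF bT] assms] by simp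
  finally show "v \<in> chart_dom J0 b" "bproj M (param b T v) = chart_param J0 b v"
    using chart_param_eqI[OF base_chart[OF bT(1)] 1(1)] by auto
qed

lemma param_coord:
  assumes "bproj M p \<in> fst b" "bproj M p \<in> fst T"
  shows "param b T (coord b T p) = p" "coord b T p \<in> cdom b T"
  using chart_param_inv[OF total_chart[OF bT], of p] assms by (auto simp: mem_chart)

lemma coord_inj:
  assumes "bproj M p \<in> fst b" "bproj M p \<in> fst T" "bproj M q \<in> fst b" "bproj M q \<in> fst T"
    "coord b T p = coord b T q"
  shows "p = q"
  using assms param_coord by metis

lemma fibre_eqI:
  assumes "bproj M p \<in> fst b" "bproj M p \<in> fst T" "bproj M q = bproj M p"
    "\<And>i. i \<in> JF \<Longrightarrow> coord b T p $ i = coord b T q $ i"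
  shows "p = q"
proof (rule coord_inj)
  have "coord b T p $ i = coord b T q $ i" for i
    using assms coord_nth(2)[of p i] coord_nth(2)[of q i] by (cases "i \<in> JF") auto
  then show "coord b T p = coord b T q" by (simp add: vec_eq_iff)
qed (use assms in auto)

end

text \<open>Smoothness into the manifold asks for every chart of the atlas; a map with image in a
  single chart domain needs to be checked there only, since the transition maps take care of the
  rest.\<close>

lemma smooth_into_param:
  fixes S :: "'e::real_normed_vector set"
  assumes bT: "b \<in> base_atlas M" "T \<in> trivs M" and S: "open S"
    and w: "smooth_on S w" "\<And>e. e \<in> S \<Longrightarrow> w e \<in> cdom b T"
    and k: "\<And>e. e \<in> S \<Longrightarrow> k e = param b T (w e)"
  shows "smooth_into (total_atlas M) S k"
  unfolding smooth_into_def
proof (intro conjI ballI)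
  note cw = smooth_on_continuous[OF w(1)]
  have "continuous_on S (\<lambda>e. param b T (w e))"
    by (rule continuous_on_compose2[OF continuous_on_chart_param[OF total_chart[OF bT]] cw])
      (use w in auto)
  then show "continuous_on S k" using k by (simp cong: continuous_on_cong)
  fix c' assume "c' \<in> total_atlas M"
  then obtain b' T' where c': "c' = graded_chart M b' T'" "b' \<in> base_atlas M" "T' \<in> trivs M"
    unfolding total_atlas_def by blast
  let ?D = "{v \<in> cdom b T. param b T v \<in> fst (graded_chart M b' T')}"
  note op = open_transition_domain[OF bT c'(2,3)]
  have eq: "{e \<in> S. k e \<in> fst c'} = S \<inter> w -` ?D" using w k by (auto simp: c'(1))
  have op': "open (S \<inter> w -` ?D)" by (rule continuous_open_preimage[OF cw S op])
  have "smooth_on (S \<inter> w -` ?D) (\<lambda>e. coord b' T' (param b T (w e)))"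
    by (rule smooth_on_compose[OF op' op _ smooth_on_subset[OF w(1)] transition_smooth[OF bT c'(2,3)]])
      auto
  then show "smooth_on {e \<in> S. k e \<in> fst c'} (\<lambda>e. snd c' (k e))"
    unfolding eq by (rule smooth_on_cong[OF op', rotated]) (auto simp: c'(1) k)
qed

section \<open>Homotheties and cutoff functions from the base\<close>

lemma homothety_ex:
  "\<exists>!q. bproj M q = bproj M p \<and>
        (\<forall>T\<in>trivs M. bproj M p \<in> fst T \<longrightarrow>
           (\<forall>i\<in>JF. snd T q $ i = t ^ wt M i * snd T p $ i))"
proof -
  obtain b T where bT: "b \<in> base_atlas M" "T \<in> trivs M" "bproj M p \<in> fst b" "bproj M p \<in> fst T"
    by (rule base_cover)
  obtain q where q: "bproj M q = bproj M p"
      "snd T q = restr JF (\<chi> i. t ^ wt M i * snd T p $ i)"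
    using triv_surj[OF bT(2,4) restr_in_coord_space] by blast
  \<comment> \<open>One trivialization determines \<open>q\<close>; homogeneity of the transition
    polynomials transfers the scaling to all the others.\<close>
  have "snd T' q $ i = t ^ wt M i * snd T' p $ i"
    if T': "T' \<in> trivs M" "bproj M p \<in> fst T'" "i \<in> JF" for T' i
  proof -
    obtain P where P: "weighted_poly JF (wt M) (wt M i) P"
      "\<forall>r. bproj M r = bproj M p \<longrightarrow> snd T' r $ i = P (snd T r)"
      using triv_transition[OF bT(2) T'(1) bT(4) T'(2,3)] by metis
    have "P (snd T q) = t ^ wt M i * P (snd T p)"
      by (rule weighted_poly_scale[OF P(1)]) (simp add: q restr_def)
    then show ?thesis using P(2) q by simp
  qed
  then show ?thesis
  proof (intro ex1I[of _ q] conjI ballI impI q(1))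
    fix r assume r: "bproj M r = bproj M p \<and>
        (\<forall>T\<in>trivs M. bproj M p \<in> fst T \<longrightarrow> (\<forall>i\<in>JF. snd T r $ i = t ^ wt M i * snd T p $ i))"
    have "snd T r = snd T q"
      unfolding vec_eq_iff
    proof
      fix i show "snd T r $ i = snd T q $ i"
        using r bT q triv_range[OF bT(2), of r]
        by (cases "i \<in> JF") (auto simp: restr_def coord_space_def)
    qed
    then show "r = q" using triv_inj[OF bT(2), of q r] q r bT by auto
  qed auto
qed

lemma homothety_coord:
  assumes "b \<in> base_atlas M" "T \<in> trivs M" "bproj M p \<in> fst b" "bproj M p \<in> fst T"
  shows "coord b T (homothety M t p) $ i = t ^ wt M i * coord b T p $ i"
proof -
  note h = theI'[OF homothety_ex, of p t, folded homothety_def]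
  consider "i \<in> JF" | "i \<in> J0" "i \<notin> JF" | "i \<notin> idx M" by (rule idx_cases)
  then show ?thesis
    by cases (use h assms coord_nth[OF assms(1,2)] in \<open>auto simp: idx_of_def\<close>)
qed

lemma bproj_homothety: "bproj M (homothety M t p) = bproj M p"
  using theI'[OF homothety_ex, of p t, folded homothety_def] by blast

text \<open>The cutoff \<open>\<phi>\<close> lives on coordinates and sees only those of the base.
  Its support is therefore controlled in the base, where it is compact, although the fibres are not.
  The factor \<open>h\<close> is arbitrary so that the same cutoff serves for constants, base
  coordinates and fibre coordinates.\<close>

lemma base_bump:
  assumes bT: "b \<in> base_atlas M" "T \<in> trivs M" and x: "x \<in> fst b" "x \<in> fst T"
  shows "\<exists>\<phi>. (\<forall>v w. (\<forall>i\<in>J0. v $ i = w $ i) \<longrightarrow> \<phi> v = \<phi> w) \<and>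
    (\<forall>p. bproj M p = x \<longrightarrow> \<phi> (coord b T p) = (1::real)) \<and>
    (\<forall>h. smooth_on UNIV h \<longrightarrow> smooth_fun M
      (\<lambda>p. if bproj M p \<in> fst b \<inter> fst T then \<phi> (coord b T p) * h (coord b T p) else 0))"
proof -
  let ?U = "fst b \<inter> fst T"
  let ?z = "snd b x"
  have chb: "is_chart J0 b" by (rule base_chart[OF bT(1)])
  have openU: "open ?U"
    by (intro open_Int chart_open[OF chb]) (rule triv_homeo[OF bT(2)])
  obtain g where g: "homeomorphism (fst b) (snd b ` fst b) (snd b) g"
    using chb unfolding is_chart_def by blast
  have "openin (top_of_set (coord_space J0)) (snd b ` ?U)"
    using openin_chart_image[OF chb openU] by blast
  then obtain e where e: "e > 0" "cball ?z e \<inter> coord_space J0 \<subseteq> snd b ` ?U"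
    unfolding openin_contains_cball using x by blast
  \<comment> \<open>\<open>C\<close> contains the support in the base. It is compact, hence closed
    because the base is Hausdorff, and this makes the extension by zero smooth.\<close>
  define C where "C = g ` (cball ?z e \<inter> coord_space J0)"
  have "compact C" unfolding C_def
    by (intro compact_continuous_image compact_Int_closed closed_coord_space compact_cball
        continuous_on_subset[OF homeomorphism_cont2[OF g]]) (use e in auto)
  then have "closed C" by (rule compact_imp_closed)
  have "C \<subseteq> ?U"
    using e(2) homeomorphism_apply1[OF g] unfolding C_def by fastforce
  \<comment> \<open>\<open>s\<close> is positive exactly where the base coordinates lie in the open
    ball of radius \<open>e\<close>, and it is \<open>e\<^sup>2\<close> at the centre, which
    explains the normalizing divisor in \<open>\<phi>\<close>.\<close>
  define s where "s v = e\<^sup>2 - (\<Sum>i\<in>J0. (v $ i - ?z $ i)\<^sup>2)" for v :: "real ^ 'i"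
  define \<phi> where "\<phi> v = flat_exp 0 (s v) * (1 / flat_exp 0 (e\<^sup>2))" for v :: "real ^ 'i"
  have "smooth_on UNIV s" unfolding s_def
    by (intro smooth_on_diff smooth_on_sum smooth_on_power smooth_on_const open_UNIV
        smooth_on_bounded_linear bounded_linear_vec_nth)
  then have sm\<phi>: "smooth_on UNIV \<phi>" unfolding \<phi>_def
    by (intro smooth_on_mult smooth_on_const open_UNIV
        smooth_on_compose[OF open_UNIV open_UNIV _ _ smooth_on_flat_exp]) auto
  have dep: "\<phi> v = \<phi> w" if "\<And>i. i \<in> J0 \<Longrightarrow> v $ i = w $ i" for v w
    using that by (simp add: \<phi>_def s_def)
  have one: "\<phi> (coord b T p) = 1" if p: "bproj M p = x" for p
  proof -
    have "coord b T p $ i = ?z $ i" if "i \<in> J0" for i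
      using coord_nth(2)[OF bT, of p i] x p that by (cases i rule: idx_cases) auto
    then show ?thesis using e by (simp add: \<phi>_def s_def flat_exp_def)
  qed
  have supp: "bproj M p \<in> C" if p: "bproj M p \<in> ?U" "\<phi> (coord b T p) \<noteq> 0" for p
  proof -
    let ?w = "snd b (bproj M p)"
    have cs: "?w \<in> coord_space J0" "?z \<in> coord_space J0" using chart_range[OF chb] p x by auto
    have "coord b T p $ i = ?w $ i" if "i \<in> J0" for i
      using coord_nth(2)[OF bT, of p i] p that by (cases i rule: idx_cases) auto
    then have "(\<Sum>i\<in>J0. (?w $ i - ?z $ i)\<^sup>2) < e\<^sup>2"
      using p(2) by (auto simp: \<phi>_def s_def flat_exp_def split: if_splits)
    also have "(\<Sum>i\<in>J0. (?w $ i - ?z $ i)\<^sup>2) = (\<Sum>i\<in>UNIV. (?w $ i - ?z $ i)\<^sup>2)"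
      using cs by (intro sum.mono_neutral_left) (auto simp: coord_space_def)
    also have "\<dots> = (dist ?z ?w)\<^sup>2"
      unfolding dist_norm norm_minus_commute[of ?z] power2_norm_eq_inner
      by (simp add: inner_vec_def power2_eq_square)
    finally have "dist ?z ?w < e" using e(1) power_less_imp_less_base by fastforce
    then have "?w \<in> cball ?z e \<inter> coord_space J0" using cs by simp
    moreover have "g ?w = bproj M p" using homeomorphism_apply1[OF g] p by simp
    ultimately show ?thesis unfolding C_def by (metis image_eqI)
  qed
  have "smooth_fun M
      (\<lambda>p. if bproj M p \<in> ?U then \<phi> (coord b T p) * h (coord b T p) else 0)"
    (is "smooth_fun M ?f") if h: "smooth_on UNIV h" for h
    unfolding smooth_fun_on_def
  proof
    fix c' assume "c' \<in> total_atlas M"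
    then obtain b' T' where c': "c' = graded_chart M b' T'" "b' \<in> base_atlas M" "T' \<in> trivs M"
      unfolding total_atlas_def by blast
    show "smooth_on {v \<in> chart_dom (idx M) c'. chart_param (idx M) c' v \<in> UNIV}
        (\<lambda>v. ?f (chart_param (idx M) c' v))"
      unfolding c'(1)
    proof (rule smooth_on_local)
      fix v assume v: "v \<in> {v \<in> cdom b' T'. param b' T' v \<in> UNIV}"
      \<comment> \<open>These two open sets cover the chart, because \<open>C\<close> lies inside
        the domain of \<open>b\<close> and \<open>T\<close>: on \<open>?N1\<close> the formula
        applies, on \<open>?N2\<close> the function is zero.\<close>
      let ?N1 = "{v \<in> cdom b' T'. param b' T' v \<in> fst (graded_chart M b T)}"
      let ?N2 = "{v \<in> cdom b' T'. param b' T' v \<in> bproj M -` (- C)}"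
      show "\<exists>N. open N \<and> v \<in> N \<and> smooth_on N (\<lambda>v. ?f (param b' T' v))"
      proof (cases "bproj M (param b' T' v) \<in> ?U")
        case True
        note op = open_transition_domain[OF c'(2,3) bT]
        note tr = transition_smooth[OF c'(2,3) bT]
        have "smooth_on ?N1 (\<lambda>v. \<phi> (coord b T (param b' T' v)) * h (coord b T (param b' T' v)))"
          by (intro smooth_on_mult op smooth_on_compose[OF op open_UNIV _ tr] sm\<phi> h) auto
        then have "smooth_on ?N1 (\<lambda>v. ?f (param b' T' v))"
          by (rule smooth_on_cong[OF op, rotated]) (auto simp: mem_chart)
        then show ?thesis using op True v by (intro exI[of _ ?N1]) (auto simp: mem_chart)
      next
        case False
        have "open (bproj M -` (- C))"
          using \<open>closed C\<close> continuous_bproj by (simp add: continuous_on_open_vimage open_Compl)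
        then have op: "open ?N2" by (rule open_chart_param_vimage[OF total_chart[OF c'(2,3)]])
        have "smooth_on ?N2 (\<lambda>v. ?f (param b' T' v))"
          by (rule smooth_on_cong[OF op _ smooth_on_const[OF op, of 0]]) (use supp in auto)
        then show ?thesis using op False v \<open>C \<subseteq> ?U\<close> by (intro exI[of _ ?N2]) auto
      qed
    qed
  qed
  note sm = this
  show ?thesis
  proof (intro exI[of _ \<phi>] conjI allI impI)
    show "\<phi> v = \<phi> w" if "\<forall>i\<in>J0. v $ i = w $ i" for v w
      by (rule dep) (rule bspec[OF that])
  qed (fact one, fact sm)
qed

end

section \<open>The flow in coordinates\<close>

definition lin_part :: "'i set \<Rightarrow> ('i \<Rightarrow> 'i \<Rightarrow> real) \<Rightarrow> real ^ 'i \<Rightarrow> 'i::finite \<Rightarrow> real" where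
  "lin_part K A v i = (\<Sum>j\<in>K. A i j * v $ j)"

text \<open>Kept as a bilinear form in two arguments, with the factor 1/2 built in. \<open>I\<close>
  is not assumed symmetric in its lower indices, so both mixed terms appear when a sum is
  expanded.\<close>

definition quad_part ::
  "'i set \<Rightarrow> ('i \<Rightarrow> 'i \<Rightarrow> 'i \<Rightarrow> real) \<Rightarrow> real ^ 'i \<Rightarrow> real ^ 'i \<Rightarrow> 'i::finite \<Rightarrow> real" where
  "quad_part K B u v i = 1/2 * (\<Sum>s\<in>K. \<Sum>r\<in>K. B i s r * u $ s * v $ r)"

lemma lin_part_comb:
  assumes "\<And>j. j \<in> K \<Longrightarrow> w $ j = u $ j + t * z $ j + s * y $ j"
  shows "lin_part K A w i = lin_part K A u i + t * lin_part K A z i + s * lin_part K A y i"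
  unfolding lin_part_def
  by (simp add: assms sum.distrib sum_distrib_left algebra_simps)

lemma quad_part_comb:
  assumes "\<And>j. j \<in> K \<Longrightarrow> w $ j = u $ j + t * z $ j"
  shows "quad_part K B w w i = quad_part K B u u i
    + t * (quad_part K B u z i + quad_part K B z u i) + t\<^sup>2 * quad_part K B z z i"
  unfolding quad_part_def
  by (simp add: assms sum.distrib sum_distrib_left algebra_simps power2_eq_square)

lemma lin_part_scale:
  assumes "\<And>j. j \<in> K \<Longrightarrow> w $ j = t * u $ j"
  shows "lin_part K A w i = t * lin_part K A u i"
  unfolding lin_part_def by (simp add: assms sum_distrib_left algebra_simps)

lemma quad_part_scale:
  assumes "\<And>j. j \<in> K \<Longrightarrow> w $ j = t * u $ j"
  shows "quad_part K B w w i = t\<^sup>2 * quad_part K B u u i"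
  unfolding quad_part_def
  by (simp add: assms sum_distrib_left algebra_simps power2_eq_square)

lemma quad_part_0:
  assumes "\<And>j. j \<in> K \<Longrightarrow> u $ j = 0"
  shows "quad_part K B u v i = 0" "quad_part K B v u i = 0"
  unfolding quad_part_def by (simp_all add: assms)

lemma lin_part_0:
  assumes "\<And>j. j \<in> K \<Longrightarrow> u $ j = 0"
  shows "lin_part K A u i = 0"
  unfolding lin_part_def by (simp add: assms)

text \<open>The values at one base point of the coefficient functions; \<open>J1\<close>, \<open>J2\<close>, \<open>J3\<close> are the
  index sets of the coordinates of weight 1, 2, 3.\<close>

locale jet_coefficients =
  fixes J1 J2 J3 :: "'i::finite set"
    and F :: "'i \<Rightarrow> real" and G H :: "'i \<Rightarrow> 'i \<Rightarrow> real" and I :: "'i \<Rightarrow> 'i \<Rightarrow> 'i \<Rightarrow> real"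
  assumes disjoint: "J1 \<inter> J2 = {}" "J1 \<inter> J3 = {}" "J2 \<inter> J3 = {}"
begin

definition velocity :: "real ^ 'i \<Rightarrow> real ^ 'i" where
  "velocity v = (\<chi> i. if i \<in> J1 then F i
     else if i \<in> J2 then lin_part J1 G v i
     else if i \<in> J3 then lin_part J2 H v i + quad_part J1 I v v i else 0)"

text \<open>Packaging \<open>F\<close> and \<open>G v\<close> as vectors allows the iterated
  products \<open>G F\<close>, \<open>H G v\<close> and \<open>H G F\<close> in the Taylor
  coefficients of the flow to be written with \<open>lin_part\<close>.\<close>

definition fvec :: "real ^ 'i" where "fvec = (\<chi> i. F i)"

definition gvec :: "real ^ 'i \<Rightarrow> real ^ 'i" where "gvec v = (\<chi> i. lin_part J1 G v i)"

text \<open>Found by integrating the system weight by weight: weight 1 is affine in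
  \<open>t\<close>, weight 2 integrates it once, weight 3 once more. The factor 2 in the cubic term
  arises because the quadratic form contributes \<open>t\<^sup>2\<close> times its value at
  \<open>fvec\<close>, which integrates to \<open>t ^ 3 / 3\<close>.\<close>

definition flow_poly :: "real \<Rightarrow> real ^ 'i \<Rightarrow> real ^ 'i" where
  "flow_poly t v = (\<chi> i. if i \<in> J1 then v $ i + t * F i
     else if i \<in> J2 then v $ i + t * lin_part J1 G v i + t\<^sup>2 / 2 * lin_part J1 G fvec i
     else if i \<in> J3 then v $ i + t * (lin_part J2 H v i + quad_part J1 I v v i)
       + t\<^sup>2 / 2 * (lin_part J2 H (gvec v) i + quad_part J1 I v fvec i + quad_part J1 I fvec v i)
       + t ^ 3 / 6 * (lin_part J2 H (gvec fvec) i + 2 * quad_part J1 I fvec fvec i)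
     else v $ i)"

definition jet_poly :: "real \<times> real \<Rightarrow> real ^ 'i \<Rightarrow> real ^ 'i" where
  "jet_poly g v = (\<chi> i. if i \<in> J1 then fst g * v $ i
     else if i \<in> J2 then (fst g)\<^sup>2 * v $ i + snd g * lin_part J1 G v i
     else if i \<in> J3 then (fst g) ^ 3 * v $ i
       + fst g * snd g * (lin_part J2 H v i + quad_part J1 I v v i)
     else v $ i)"

lemma idx3_cases:
  obtains "i \<in> J1" "i \<notin> J2" "i \<notin> J3" | "i \<in> J2" "i \<notin> J1" "i \<notin> J3"
  | "i \<in> J3" "i \<notin> J1" "i \<notin> J2" | "i \<notin> J1" "i \<notin> J2" "i \<notin> J3"
  using disjoint by blast

lemma velocity_flow_poly:
  "i \<in> J1 \<Longrightarrow> velocity (flow_poly t v) $ i = F i"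
  "i \<in> J2 \<Longrightarrow> velocity (flow_poly t v) $ i = lin_part J1 G v i + t * lin_part J1 G fvec i"
  "i \<in> J3 \<Longrightarrow> velocity (flow_poly t v) $ i = lin_part J2 H v i + quad_part J1 I v v i
     + t * (lin_part J2 H (gvec v) i + quad_part J1 I v fvec i + quad_part J1 I fvec v i)
     + t\<^sup>2 / 2 * (lin_part J2 H (gvec fvec) i + 2 * quad_part J1 I fvec fvec i)"
proof -
  have 1: "flow_poly t v $ j = v $ j + t * fvec $ j" if "j \<in> J1" for j
    using that by (simp add: flow_poly_def fvec_def)
  have 2: "flow_poly t v $ j = v $ j + t * gvec v $ j + t\<^sup>2 / 2 * gvec fvec $ j" if "j \<in> J2" for j
    using that disjoint by (auto simp add: flow_poly_def gvec_def)
  have l1: "lin_part J1 G (flow_poly t v) i = lin_part J1 G v i + t * lin_part J1 G fvec i"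
    using lin_part_comb[of J1 "flow_poly t v" v t fvec 0 0 G i] 1 by simp
  have l2: "lin_part J2 H (flow_poly t v) i = lin_part J2 H v i + t * lin_part J2 H (gvec v) i
      + t\<^sup>2 / 2 * lin_part J2 H (gvec fvec) i"
    using lin_part_comb[OF 2] .
  have q: "quad_part J1 I (flow_poly t v) (flow_poly t v) i = quad_part J1 I v v i
    + t * (quad_part J1 I v fvec i + quad_part J1 I fvec v i) + t\<^sup>2 * quad_part J1 I fvec fvec i"
    using quad_part_comb[OF 1] .
  show "i \<in> J1 \<Longrightarrow> velocity (flow_poly t v) $ i = F i" by (simp add: velocity_def)
  show "i \<in> J2 \<Longrightarrow> velocity (flow_poly t v) $ i = lin_part J1 G v i + t * lin_part J1 G fvec i"
    using disjoint l1 by (auto simp add: velocity_def)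
  show "i \<in> J3 \<Longrightarrow> velocity (flow_poly t v) $ i = lin_part J2 H v i + quad_part J1 I v v i
     + t * (lin_part J2 H (gvec v) i + quad_part J1 I v fvec i + quad_part J1 I fvec v i)
     + t\<^sup>2 / 2 * (lin_part J2 H (gvec fvec) i + 2 * quad_part J1 I fvec fvec i)"
    by (cases i rule: idx3_cases) (auto simp: velocity_def l2 q algebra_simps)
qed

lemma velocity_0: "i \<notin> J1 \<Longrightarrow> i \<notin> J2 \<Longrightarrow> i \<notin> J3 \<Longrightarrow> velocity v $ i = 0"
  by (simp add: velocity_def)

lemma flow_poly_0: "flow_poly 0 v = v"
  by (simp add: flow_poly_def vec_eq_iff)

lemma flow_poly_fixed: "i \<notin> J1 \<Longrightarrow> i \<notin> J2 \<Longrightarrow> i \<notin> J3 \<Longrightarrow> flow_poly t v $ i = v $ i"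
  by (simp add: flow_poly_def)

lemma flow_poly_deriv:
  "((\<lambda>t. flow_poly t v $ i) has_real_derivative velocity (flow_poly t v) $ i) (at t)"
  by (cases i rule: idx3_cases)
    (auto simp: flow_poly_def velocity_flow_poly[unfolded flow_poly_def] velocity_0
      intro!: derivative_eq_intros)

lemma flow_poly_vderiv:
  "((\<lambda>t. flow_poly t v) has_vector_derivative velocity (flow_poly t v)) (at t)"
proof -
  have eq: "flow_poly s v = (\<Sum>i\<in>UNIV. flow_poly s v $ i *\<^sub>R axis i 1)" for s
    by (auto simp: vec_eq_iff axis_def if_distrib cong: if_cong)
  have eq2: "velocity (flow_poly t v) = (\<Sum>i\<in>UNIV. velocity (flow_poly t v) $ i *\<^sub>R axis i 1)"
    by (auto simp: vec_eq_iff axis_def if_distrib cong: if_cong)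
  have "((\<lambda>s. flow_poly s v $ i *\<^sub>R (axis i 1 :: real ^ 'i)) has_vector_derivative
      velocity (flow_poly t v) $ i *\<^sub>R axis i 1) (at t)" for i
    using has_vector_derivative_scaleR[OF flow_poly_deriv has_vector_derivative_const] by simp
  then have "((\<lambda>s. \<Sum>i\<in>UNIV. flow_poly s v $ i *\<^sub>R (axis i 1 :: real ^ 'i)) has_vector_derivative
      (\<Sum>i\<in>UNIV. velocity (flow_poly t v) $ i *\<^sub>R axis i 1)) (at t)"
    by (intro has_vector_derivative_sum) auto
  then show ?thesis using eq eq2 by simp
qed

text \<open>No general uniqueness theorem is involved. The velocity of a coordinate depends only on
  coordinates of lower weight, so once those agree with the polynomial solution, the difference of
  the two curves has derivative zero in the next weight.\<close>

lemma flow_poly_unique: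
  assumes deriv: "\<And>i t. i \<in> J1 \<union> J2 \<union> J3 \<Longrightarrow>
      ((\<lambda>s. w s $ i) has_real_derivative velocity (w t) $ i) (at t)"
    and i: "i \<in> J1 \<union> J2 \<union> J3"
  shows "w t $ i = flow_poly t (w 0) $ i"
proof -
  let ?p = "\<lambda>t. flow_poly t (w 0)"
  have step: "w t $ i = ?p t $ i"
    if "i \<in> J1 \<union> J2 \<union> J3" "\<And>t. velocity (w t) $ i = velocity (?p t) $ i" for i t
  proof -
    have "((\<lambda>s. w s $ i - ?p s $ i) has_real_derivative 0) (at s)" for s
      using DERIV_diff[OF deriv[OF that(1), of s] flow_poly_deriv[of "w 0" i s]]
      unfolding that(2) diff_self .
    then have "w t $ i - ?p t $ i = w 0 $ i - ?p 0 $ i"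
      by (intro DERIV_isconst_all) auto
    then show ?thesis by (simp add: flow_poly_0)
  qed
  have 1: "w t $ i = ?p t $ i" if "i \<in> J1" for i t
    using that by (intro step) (auto simp: velocity_def)
  then have l: "lin_part J1 G (w t) i = lin_part J1 G (?p t) i"
    and q: "quad_part J1 I (w t) (w t) i = quad_part J1 I (?p t) (?p t) i" for t i
    by (auto simp: lin_part_def quad_part_def)
  have 2: "w t $ i = ?p t $ i" if "i \<in> J2" for i t
    using that disjoint by (intro step) (auto simp: velocity_def l)
  then have l2: "lin_part J2 H (w t) i = lin_part J2 H (?p t) i" for t i
    by (auto simp: lin_part_def)
  have 3: "w t $ i = ?p t $ i" if "i \<in> J3" for i t
    using that disjoint by (intro step) (auto simp: velocity_def q l2)
  show ?thesis using i 1 2 3 by blast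
qed

text \<open>Links the two descriptions of the field: with \<open>D\<close> the derivative of a
  function in coordinates, the right-hand side is the given local form.\<close>

lemma velocity_sum:
  assumes "linear D"
  shows "D (velocity v) = (\<Sum>s\<in>J1. F s * D (axis s 1)) + (\<Sum>s\<in>J2. lin_part J1 G v s * D (axis s 1))
    + (\<Sum>s\<in>J3. (lin_part J2 H v s + quad_part J1 I v v s) * (D (axis s 1) :: real))"
proof -
  have "velocity v = (\<Sum>i\<in>UNIV. velocity v $ i *\<^sub>R axis i 1)"
    by (auto simp: vec_eq_iff axis_def if_distrib cong: if_cong)
  then have "D (velocity v) = D (\<Sum>i\<in>UNIV. velocity v $ i *\<^sub>R axis i 1)" by simp
  also have "\<dots> = (\<Sum>i\<in>UNIV. velocity v $ i * D (axis i 1))"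
    by (simp add: linear_sum[OF assms] linear_scale[OF assms])
  also have "\<dots> = (\<Sum>i\<in>J1 \<union> J2 \<union> J3. velocity v $ i * D (axis i 1))"
    by (rule sum.mono_neutral_right) (auto simp: velocity_0)
  also have "\<dots> = (\<Sum>i\<in>J1. velocity v $ i * D (axis i 1)) + (\<Sum>i\<in>J2. velocity v $ i * D (axis i 1))
      + (\<Sum>i\<in>J3. velocity v $ i * D (axis i 1))"
    using disjoint by (subst sum.union_disjoint; (subst sum.union_disjoint)?) auto
  finally show ?thesis
    using disjoint by (auto simp: velocity_def intro!: arg_cong2[where f="(+)"] sum.cong)
qed

lemma jet_poly_one: "jet_poly G2_one v = v"
  by (simp add: jet_poly_def vec_eq_iff G2_one_def)

text \<open>Exchanging the sums exhibits the product matrix \<open>H G\<close>, whose entries are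
  the sums in the condition on the coefficients.\<close>

lemma lin_part_gvec: "lin_part J2 H (gvec v) i = (\<Sum>s\<in>J1. (\<Sum>S\<in>J2. H i S * G S s) * v $ s)"
  unfolding lin_part_def gvec_def
  by (simp add: sum_distrib_left sum_distrib_right mult.assoc) (rule sum.swap)

lemma smooth_flow_poly: "smooth_on UNIV (\<lambda>t. flow_poly t v)"
proof (rule smooth_on_vec)
  fix i
  show "smooth_on UNIV (\<lambda>t. flow_poly t v $ i)"
    by (cases i rule: idx3_cases; simp only: flow_poly_def vec_lambda_beta if_True if_False simp_thms)
      (intro smooth_on_add smooth_on_mult smooth_on_power smooth_on_divide_const smooth_on_ident
        smooth_on_const open_UNIV)+
qed simp

lemma jet_poly_fixed: "i \<notin> J1 \<Longrightarrow> i \<notin> J2 \<Longrightarrow> i \<notin> J3 \<Longrightarrow> jet_poly g v $ i = v $ i"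
  by (simp add: jet_poly_def)

lemma smooth_jet_poly: "smooth_on UNIV (\<lambda>g. jet_poly g v)"
proof (rule smooth_on_vec)
  fix i
  show "smooth_on UNIV (\<lambda>g. jet_poly g v $ i)"
    by (cases i rule: idx3_cases; simp only: jet_poly_def vec_lambda_beta if_True if_False simp_thms)
      (intro smooth_on_add smooth_on_mult smooth_on_power smooth_on_const
        smooth_on_bounded_linear bounded_linear_fst bounded_linear_snd open_UNIV)+
qed simp

text \<open>In the monoid, \<open>(a, a\<^sup>2 * t)\<close> is the product of \<open>(1, t)\<close>
  and \<open>(a, 0)\<close>, and \<open>(a, 0)\<close> acts as the homothety by
  \<open>a\<close>.\<close>

lemma jet_poly_scaled:
  "i \<in> J1 \<Longrightarrow> jet_poly (a, a\<^sup>2 * t) v $ i = a * jet_poly (1, t) v $ i"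
  "i \<in> J2 \<Longrightarrow> jet_poly (a, a\<^sup>2 * t) v $ i = a\<^sup>2 * jet_poly (1, t) v $ i"
  "i \<in> J3 \<Longrightarrow> jet_poly (a, a\<^sup>2 * t) v $ i = a ^ 3 * jet_poly (1, t) v $ i"
  "i \<notin> J1 \<Longrightarrow> i \<notin> J2 \<Longrightarrow> i \<notin> J3 \<Longrightarrow> jet_poly (a, a\<^sup>2 * t) v $ i = jet_poly (1, t) v $ i"
  by (cases i rule: idx3_cases;
      simp add: jet_poly_def algebra_simps power2_eq_square power3_eq_cube)+

section \<open>The polynomial action when the obstructing coefficients are zero\<close>

context
  assumes F0: "\<And>s. s \<in> J1 \<Longrightarrow> F s = 0"
begin

lemma flow_poly_F0:
  "flow_poly t v = (\<chi> i. if i \<in> J2 then v $ i + t * lin_part J1 G v i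
     else if i \<in> J3 then v $ i + t * (lin_part J2 H v i + quad_part J1 I v v i)
       + t\<^sup>2 / 2 * lin_part J2 H (gvec v) i else v $ i)"
proof -
  have f: "fvec $ j = 0" if "j \<in> J1" for j using that F0 by (simp add: fvec_def)
  have "lin_part J1 G fvec i = 0" for i by (rule lin_part_0[OF f])
  then have g: "gvec fvec $ j = 0" for j by (simp add: gvec_def)
  show ?thesis unfolding vec_eq_iff
  proof
    fix i
    show "flow_poly t v $ i = (\<chi> i. if i \<in> J2 then v $ i + t * lin_part J1 G v i
     else if i \<in> J3 then v $ i + t * (lin_part J2 H v i + quad_part J1 I v v i)
       + t\<^sup>2 / 2 * lin_part J2 H (gvec v) i else v $ i) $ i"
      by (cases i rule: idx3_cases)
        (simp_all add: flow_poly_def F0 quad_part_0[OF f] lin_part_0[OF f] lin_part_0[OF g])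
  qed
qed

context
  assumes HG: "\<And>\<sigma> s. \<sigma> \<in> J3 \<Longrightarrow> s \<in> J1 \<Longrightarrow> (\<Sum>S\<in>J2. H \<sigma> S * G S s) = 0"
begin

text \<open>With the quadratic term of the flow gone, time enters linearly: \<beta>/a meets a factor
  \<open>a\<close> in weight 2 and \<open>a\<^sup>2\<close> in weight 3, so no negative power of
  \<open>a\<close> is left.\<close>

lemma flow_poly_scaled:
  assumes "a \<noteq> 0" "\<And>i. i \<in> J1 \<Longrightarrow> w $ i = a * v $ i" "\<And>i. i \<in> J2 \<Longrightarrow> w $ i = a\<^sup>2 * v $ i"
    "\<And>i. i \<in> J3 \<Longrightarrow> w $ i = a ^ 3 * v $ i"
    "\<And>i. i \<notin> J1 \<Longrightarrow> i \<notin> J2 \<Longrightarrow> i \<notin> J3 \<Longrightarrow> w $ i = v $ i"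
  shows "flow_poly (\<beta> / a) w = jet_poly (a, \<beta>) v"
  unfolding vec_eq_iff
proof
  fix i
  have l: "lin_part J1 G w i = a * lin_part J1 G v i" by (rule lin_part_scale) (rule assms(2))
  have l2: "lin_part J2 H w i = a\<^sup>2 * lin_part J2 H v i" by (rule lin_part_scale) (rule assms(3))
  have q: "quad_part J1 I w w i = a\<^sup>2 * quad_part J1 I v v i" by (rule quad_part_scale) (rule assms(2))
  show "flow_poly (\<beta> / a) w $ i = jet_poly (a, \<beta>) v $ i"
  proof (cases i rule: idx3_cases)
    case 3
    then have "lin_part J2 H (gvec w) i = 0" by (simp add: lin_part_gvec HG)
    then show ?thesis using 3 assms
      by (simp add: flow_poly_F0 jet_poly_def l2 q) (simp add: field_simps power2_eq_square)
  qed (use assms in \<open>auto simp: flow_poly_F0 jet_poly_def l\<close>)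
qed

text \<open>In weight 3, \<open>H\<close> is applied to the weight 2 part of
  \<open>jet_poly g v\<close>, which contains \<open>snd g\<close> times \<open>G v\<close>. The
  resulting term with \<open>H G v\<close> is the only one that does not fit the product of jets,
  and \<open>HG\<close> removes it.\<close>

lemma jet_poly_mult: "jet_poly h (jet_poly g v) = jet_poly (G2_mult g h) v"
  unfolding vec_eq_iff
proof
  fix i
  let ?w = "jet_poly g v"
  have 1: "?w $ j = fst g * v $ j" if "j \<in> J1" for j using that by (simp add: jet_poly_def)
  have 2: "?w $ j = 0 + (fst g)\<^sup>2 * v $ j + snd g * gvec v $ j" if "j \<in> J2" for j
    using that disjoint by (auto simp add: jet_poly_def gvec_def)
  have l: "lin_part J1 G ?w i = fst g * lin_part J1 G v i" by (rule lin_part_scale) (rule 1)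
  have q: "quad_part J1 I ?w ?w i = (fst g)\<^sup>2 * quad_part J1 I v v i"
    by (rule quad_part_scale) (rule 1)
  have l2: "lin_part J2 H ?w i = (fst g)\<^sup>2 * lin_part J2 H v i + snd g * lin_part J2 H (gvec v) i"
    using lin_part_comb[of J2 ?w 0 "(fst g)\<^sup>2" v "snd g" "gvec v" H i] 2 by (simp add: lin_part_def)
  show "jet_poly h ?w $ i = jet_poly (G2_mult g h) v $ i"
  proof (cases i rule: idx3_cases)
    case 3
    then have "lin_part J2 H (gvec v) i = 0" by (simp add: lin_part_gvec HG)
    moreover have "?w $ i = (fst g) ^ 3 * v $ i
       + fst g * snd g * (lin_part J2 H v i + quad_part J1 I v v i)"
      using 3 by (simp add: jet_poly_def)
    moreover have "jet_poly h ?w $ i = (fst h) ^ 3 * ?w $ i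
       + fst h * snd h * (lin_part J2 H ?w i + quad_part J1 I ?w ?w i)"
      using 3 by (simp add: jet_poly_def)
    moreover have "jet_poly (G2_mult g h) v $ i = (fst g * fst h) ^ 3 * v $ i
       + fst g * fst h * (fst g * snd h + snd g * (fst h)\<^sup>2) * (lin_part J2 H v i + quad_part J1 I v v i)"
      using 3 by (simp add: jet_poly_def G2_mult_def split_beta)
    ultimately show ?thesis
      unfolding l2 q by (simp add: algebra_simps power2_eq_square power3_eq_cube)
  next
    case 2
    have "?w $ i = (fst g)\<^sup>2 * v $ i + snd g * lin_part J1 G v i"
      using 2 by (simp add: jet_poly_def)
    moreover have "jet_poly h ?w $ i = (fst h)\<^sup>2 * ?w $ i + snd h * lin_part J1 G ?w i"
      using 2 by (simp add: jet_poly_def)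
    moreover have "jet_poly (G2_mult g h) v $ i = (fst g * fst h)\<^sup>2 * v $ i
        + (fst g * snd h + snd g * (fst h)\<^sup>2) * lin_part J1 G v i"
      using 2 by (simp add: jet_poly_def G2_mult_def split_beta)
    ultimately show ?thesis
      unfolding l by (simp add: algebra_simps power2_eq_square)
  qed (auto simp: jet_poly_def G2_mult_def split_beta)
qed

end

end

end

section \<open>Integral curves\<close>

locale weight_minus_one_field = graded_bundle_manifold M
  for M :: "('m::{t2_space, second_countable_topology},
               'b::{t2_space, second_countable_topology}, 'i::finite) fibre_bundle" +
  fixes X :: "('m \<Rightarrow> real) \<Rightarrow> ('m \<Rightarrow> real)"
    and F :: "('b, 'i) chart \<Rightarrow> 'b set \<times> ('m \<Rightarrow> real ^ 'i) \<Rightarrow> 'i \<Rightarrow> 'b \<Rightarrow> real"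
    and G H :: "('b, 'i) chart \<Rightarrow> 'b set \<times> ('m \<Rightarrow> real ^ 'i) \<Rightarrow> 'i \<Rightarrow> 'i \<Rightarrow> 'b \<Rightarrow> real"
    and I :: "('b, 'i) chart \<Rightarrow> 'b set \<times> ('m \<Rightarrow> real ^ 'i) \<Rightarrow> 'i \<Rightarrow> 'i \<Rightarrow> 'i \<Rightarrow> 'b \<Rightarrow> real"
  assumes degree: "degree_at_most M 3"
    and field: "vector_field M X"
    and local_form: "b \<in> base_atlas M \<Longrightarrow> T \<in> trivs M \<Longrightarrow>
      local_form M b T X (F b T) (G b T) (H b T) (I b T)"
begin

abbreviation "J1 \<equiv> idx_of M 1"
abbreviation "J2 \<equiv> idx_of M 2"
abbreviation "J3 \<equiv> idx_of M 3"

sublocale jc: jet_coefficients J1 J2 J3 "\<lambda>s. F b T s x" "\<lambda>S s. G b T S s x"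
  "\<lambda>\<sigma> S. H b T \<sigma> S x" "\<lambda>\<sigma> s r. I b T \<sigma> s r x" for b T x
  by unfold_locales (auto simp: idx_of_def)

abbreviation "vel b T x \<equiv> jet_coefficients.velocity J1 J2 J3 (\<lambda>s. F b T s x) (\<lambda>S s. G b T S s x)
  (\<lambda>\<sigma> S. H b T \<sigma> S x) (\<lambda>\<sigma> s r. I b T \<sigma> s r x)"
abbreviation "flp b T x \<equiv> jet_coefficients.flow_poly J1 J2 J3 (\<lambda>s. F b T s x) (\<lambda>S s. G b T S s x)
  (\<lambda>\<sigma> S. H b T \<sigma> S x) (\<lambda>\<sigma> s r. I b T \<sigma> s r x)"
abbreviation "jetp b T x \<equiv> jet_coefficients.jet_poly J1 J2 J3 (\<lambda>S s. G b T S s x)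
  (\<lambda>\<sigma> S. H b T \<sigma> S x) (\<lambda>\<sigma> s r. I b T \<sigma> s r x)"

text \<open>Otherwise the simplifier rewrites the \<open>1\<close> in \<open>idx_of M 1\<close>.\<close>

declare One_nat_def [simp del]

lemma fib_idx_eq: "JF = J1 \<union> J2 \<union> J3"
proof -
  have "wt M i \<in> {1, 2, 3}" if "i \<in> idx M" "wt M i > 0" for i
    using that degree unfolding degree_at_most_def by fastforce
  then show ?thesis by (auto simp: fib_idx_def idx_of_def)
qed

text \<open>Reads the local form as a derivative in the single direction \<open>vel\<close>, which
  turns statements about a derivation into calculus along curves in coordinates.\<close>

lemma X_eq:
  assumes bT: "b \<in> base_atlas M" "T \<in> trivs M" and p: "bproj M p \<in> fst b" "bproj M p \<in> fst T"
    and f: "smooth_fun M f"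
  shows "((\<lambda>v. f (param b T v)) has_derivative
      frechet_derivative (\<lambda>v. f (param b T v)) (at (coord b T p))) (at (coord b T p))"
    "X f p = frechet_derivative (\<lambda>v. f (param b T v)) (at (coord b T p))
      (vel b T (bproj M p) (coord b T p))"
proof -
  have "graded_chart M b T \<in> total_atlas M" using bT unfolding total_atlas_def by blast
  then have "smooth_on {v \<in> cdom b T. param b T v \<in> UNIV} (\<lambda>v. f (param b T v))"
    using f unfolding smooth_fun_on_def by blast
  then have "(\<lambda>v. f (param b T v)) differentiable at (coord b T p)"
    by (rule smooth_on_differentiable) (simp add: param_coord[OF bT p])
  then show d: "((\<lambda>v. f (param b T v)) has_derivative
      frechet_derivative (\<lambda>v. f (param b T v)) (at (coord b T p))) (at (coord b T p))"
    by (simp add: frechet_derivative_works)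
  have c: "coord b T p $ i = snd T p $ i" if "i \<in> J1 \<union> J2 \<union> J3" for i
    using coord_nth(1)[OF bT p] that fib_idx_eq by blast
  show "X f p = frechet_derivative (\<lambda>v. f (param b T v)) (at (coord b T p))
      (vel b T (bproj M p) (coord b T p))"
    unfolding jc.velocity_sum[OF has_derivative_linear[OF d]]
    using local_form[OF bT] f p
    by (simp add: local_form_def Let_def partial_def lin_part_def quad_part_def c cong: sum.cong)
qed

lemma X_chain:
  assumes bT: "b \<in> base_atlas M" "T \<in> trivs M" and p: "bproj M p \<in> fst b" "bproj M p \<in> fst T"
    and f: "smooth_fun M f"
    and w: "(w has_vector_derivative vel b T (bproj M p) (coord b T p)) (at t)" "w t = coord b T p"
  shows "((\<lambda>s. f (param b T (w s))) has_real_derivative X f p) (at t)"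
proof -
  let ?D = "frechet_derivative (\<lambda>v. f (param b T v)) (at (coord b T p))"
  let ?V = "vel b T (bproj M p) (coord b T p)"
  have "(((\<lambda>v. f (param b T v)) \<circ> w) has_derivative (?D \<circ> (\<lambda>h. h *\<^sub>R ?V))) (at t)"
    using w X_eq(1)[OF bT p f] by (intro diff_chain_at) (auto simp: has_vector_derivative_def)
  moreover have "?D \<circ> (\<lambda>h. h *\<^sub>R ?V) = (*) (X f p)"
    by (auto simp: X_eq(2)[OF bT p f] linear_scale[OF has_derivative_linear[OF X_eq(1)[OF bT p f]]])
  ultimately show ?thesis by (simp add: has_field_derivative_def o_def)
qed

text \<open>The velocity has no base components, so the straight line in its direction stays in the
  fibre. It computes \<open>X f\<close> from the values of \<open>f\<close> on that fibre
  alone.\<close>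

lemma X_line:
  assumes bT: "b \<in> base_atlas M" "T \<in> trivs M" and p: "bproj M p \<in> fst b" "bproj M p \<in> fst T"
    and f: "smooth_fun M f"
  defines "w \<equiv> \<lambda>s. coord b T p + s *\<^sub>R vel b T (bproj M p) (coord b T p)"
  shows "((\<lambda>s. f (param b T (w s))) has_real_derivative X f p) (at 0)"
    "bproj M (param b T (w s)) = bproj M p" "coord b T (param b T (w s)) = w s"
proof -
  show "((\<lambda>s. f (param b T (w s))) has_real_derivative X f p) (at 0)"
    unfolding w_def
    by (rule X_chain[OF bT p f]) (auto intro!: derivative_eq_intros)
  have "w s $ i = coord b T p $ i" if "i \<notin> JF" for i
    using that unfolding fib_idx_eq w_def by (simp add: jc.velocity_0)
  from param_shift[OF bT p this]
  show "bproj M (param b T (w s)) = bproj M p" "coord b T (param b T (w s)) = w s" by auto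
qed

lemma X_fibre_const:
  assumes f: "smooth_fun M f" and c: "\<And>q. bproj M q = bproj M p \<Longrightarrow> f q = f p"
  shows "X f p = 0"
proof -
  obtain b T where bT: "b \<in> base_atlas M" "T \<in> trivs M" and p: "bproj M p \<in> fst b" "bproj M p \<in> fst T"
    by (rule base_cover)
  have "((\<lambda>s. f p) has_real_derivative X f p) (at 0)"
    using X_line(1)[OF bT p f] unfolding c[OF X_line(2)[OF bT p f]] .
  then show ?thesis by (rule DERIV_unique) (rule DERIV_const)
qed

lemma X_fibre_coord:
  assumes bT: "b \<in> base_atlas M" "T \<in> trivs M" and p: "bproj M p \<in> fst b" "bproj M p \<in> fst T"
    and f: "smooth_fun M f" and c: "\<And>q. bproj M q = bproj M p \<Longrightarrow> f q = coord b T q $ i"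
  shows "X f p = vel b T (bproj M p) (coord b T p) $ i"
proof -
  let ?V = "vel b T (bproj M p) (coord b T p)"
  have "((\<lambda>s. coord b T p $ i + s * ?V $ i) has_real_derivative X f p) (at 0)"
    using X_line(1)[OF bT p f]
    unfolding c[OF X_line(2)[OF bT p f]] X_line(3)[OF bT p f] by simp
  moreover have "((\<lambda>s. coord b T p $ i + s * ?V $ i) has_real_derivative ?V $ i) (at 0)"
    by (auto intro!: derivative_eq_intros)
  ultimately show ?thesis by (rule DERIV_unique)
qed

text \<open>The local coordinate multiplied by a cutoff from the base: globally smooth, of the same
  weight, and unchanged over all of the fibre rather than merely near one point.\<close>

lemma fibre_coord_ex:
  assumes bT: "b \<in> base_atlas M" "T \<in> trivs M" and x: "x \<in> fst b" "x \<in> fst T" and i: "i \<in> JF"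
  obtains f where "smooth_fun M f" "fun_has_weight M (wt M i) f"
    "\<And>q. bproj M q = x \<Longrightarrow> f q = coord b T q $ i"
proof -
  obtain \<phi> where \<phi>: "\<forall>v w. (\<forall>i\<in>J0. v $ i = w $ i) \<longrightarrow> \<phi> v = \<phi> w"
    "\<forall>p. bproj M p = x \<longrightarrow> \<phi> (coord b T p) = 1"
    "\<forall>h. smooth_on UNIV h \<longrightarrow> smooth_fun M
      (\<lambda>p. if bproj M p \<in> fst b \<inter> fst T then \<phi> (coord b T p) * h (coord b T p) else 0)"
    using base_bump[OF bT x] by (elim exE conjE)
  note dep = \<phi>(1)[rule_format] and one = \<phi>(2)[rule_format] and sm = \<phi>(3)[rule_format]
  let ?f = "\<lambda>p. if bproj M p \<in> fst b \<inter> fst T then \<phi> (coord b T p) * coord b T p $ i else 0"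
  have "?f (homothety M t p) = t ^ wt M i * ?f p" for t p
  proof (cases "bproj M p \<in> fst b \<inter> fst T")
    case True
    then have h: "coord b T (homothety M t p) $ j = t ^ wt M j * coord b T p $ j" for j
      using homothety_coord[OF bT] by blast
    \<comment> \<open>Base coordinates are multiplied by \<open>t ^ 0\<close>, which is 1 also for
      \<open>t = 0\<close>.\<close>
    have "\<phi> (coord b T (homothety M t p)) = \<phi> (coord b T p)"
      by (rule dep) (simp add: h idx_of_def)
    then show ?thesis using True by (simp add: bproj_homothety h)
  next
    case False
    then show ?thesis by (auto simp: bproj_homothety)
  qed
  then have weight: "fun_has_weight M (wt M i) ?f" by (simp add: fun_has_weight_def)
  have smooth: "smooth_fun M ?f"
    by (intro sm smooth_on_bounded_linear open_UNIV bounded_linear_vec_nth)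
  have "?f q = coord b T q $ i" if "bproj M q = x" for q
    using that x one by simp
  from that[OF smooth weight this] show ?thesis .
qed

text \<open>A function that factors through the base is constant along the curve.  Applied to a bump
  function times \<open>1\<close>, this keeps the curve inside the chart; applied to a bump function times
  the base coordinates, it fixes the base point.\<close>

lemma curve_base:
  assumes v: "\<And>t. has_velocity M \<gamma> t X"
  shows "bproj M (\<gamma> t) = bproj M (\<gamma> 0)"
proof -
  let ?x = "bproj M (\<gamma> 0)"
  obtain b T where bT: "b \<in> base_atlas M" "T \<in> trivs M" and x: "?x \<in> fst b" "?x \<in> fst T"
    by (rule base_cover)
  obtain \<phi> where \<phi>: "\<forall>v w. (\<forall>i\<in>J0. v $ i = w $ i) \<longrightarrow> \<phi> v = \<phi> w"
    "\<forall>p. bproj M p = ?x \<longrightarrow> \<phi> (coord b T p) = 1"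
    "\<forall>h. smooth_on UNIV h \<longrightarrow> smooth_fun M
      (\<lambda>p. if bproj M p \<in> fst b \<inter> fst T then \<phi> (coord b T p) * h (coord b T p) else 0)"
    using base_bump[OF bT x] by (elim exE conjE)
  note dep = \<phi>(1)[rule_format] and one = \<phi>(2)[rule_format] and sm = \<phi>(3)[rule_format]
  define f where "f h p = (if bproj M p \<in> fst b \<inter> fst T then \<phi> (coord b T p) * h (coord b T p) else 0)"
    for h :: "real ^ 'i \<Rightarrow> real" and p
  have base: "coord b T q $ i = coord b T p $ i"
    if "bproj M q = bproj M p" "bproj M p \<in> fst b \<inter> fst T" "i \<in> J0" for p q i
    using that coord_nth(2)[OF bT, of q i] coord_nth(2)[OF bT, of p i]
    by (cases i rule: idx_cases) auto
  have const: "f h (\<gamma> t) = f h (\<gamma> 0)"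
    if h: "smooth_on UNIV h" "\<And>v w. (\<And>i. i \<in> J0 \<Longrightarrow> v $ i = w $ i) \<Longrightarrow> h v = h w" for h t
  proof -
    have smf: "smooth_fun M (f h)" unfolding f_def using sm[OF h(1)] .
    have "f h q = f h p" if "bproj M q = bproj M p" for p q
      using dep[OF base[OF that]] h(2)[OF base[OF that]] that unfolding f_def by auto
    then have "X (f h) p = 0" for p using X_fibre_const[OF smf] by blast
    then have "((\<lambda>s. f h (\<gamma> s)) has_real_derivative 0) (at s)" for s
      using v smf unfolding has_velocity_def by metis
    then show ?thesis by (intro DERIV_isconst_all) auto
  qed
  have "f (\<lambda>_. 1) (\<gamma> t) = 1"
    using const[of "\<lambda>_. 1"] one[of "\<gamma> 0"] x by (simp add: f_def)
  then have t: "bproj M (\<gamma> t) \<in> fst b \<inter> fst T" "\<phi> (coord b T (\<gamma> t)) = 1"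
    by (auto simp: f_def split: if_splits)
  have "coord b T (\<gamma> t) $ i = coord b T (\<gamma> 0) $ i" if "i \<in> J0" for i
  proof -
    have "f (\<lambda>v. v $ i) (\<gamma> t) = f (\<lambda>v. v $ i) (\<gamma> 0)"
      by (rule const)
        (use that in \<open>auto intro: smooth_on_bounded_linear[OF open_UNIV bounded_linear_vec_nth]\<close>)
    then show ?thesis using t x one[OF refl] by (simp add: f_def)
  qed
  then have "restr J0 (coord b T (\<gamma> t)) = restr J0 (coord b T (\<gamma> 0))"
    by (auto simp: restr_def vec_eq_iff)
  then have "snd b (bproj M (\<gamma> t)) = snd b ?x"
    using t x coord_nth(4)[OF bT] by simp
  then show ?thesis
    using inj_onD[OF chart_inj[OF base_chart[OF bT(1)]]] t x by blast
qed

text \<open>Since the curve stays in one fibre, the global substitute for the coordinate agrees with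
  it at every time. Only the velocity at time \<open>t\<close> is involved, so the lemma also covers
  the curves that witness tangency, which need not be integral curves.\<close>

lemma curve_coord:
  assumes bT: "b \<in> base_atlas M" "T \<in> trivs M" and x: "x \<in> fst b" "x \<in> fst T"
    and v: "has_velocity M \<gamma> t X" and \<gamma>: "\<And>s. bproj M (\<gamma> s) = x" and i: "i \<in> JF"
  shows "((\<lambda>s. coord b T (\<gamma> s) $ i) has_real_derivative vel b T x (coord b T (\<gamma> t)) $ i) (at t)"
proof -
  obtain f where f: "smooth_fun M f" "\<And>q. bproj M q = x \<Longrightarrow> f q = coord b T q $ i"
    using fibre_coord_ex[OF bT x i] by metis
  have "((\<lambda>s. f (\<gamma> s)) has_real_derivative X f (\<gamma> t)) (at t)"
    using v f(1) unfolding has_velocity_def by blast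
  moreover have "X f (\<gamma> t) = vel b T x (coord b T (\<gamma> t)) $ i"
    using X_fibre_coord[OF bT, of "\<gamma> t" f i] f x \<gamma> by simp
  ultimately show ?thesis by (simp add: f(2) \<gamma>)
qed

context
  fixes b T p
  assumes bT: "b \<in> base_atlas M" "T \<in> trivs M" and p: "bproj M p \<in> fst b" "bproj M p \<in> fst T"
begin

abbreviation (input) "fcurve \<equiv> \<lambda>t. param b T (flp b T (bproj M p) t (coord b T p))"

lemma fcurve:
  "flp b T (bproj M p) t (coord b T p) \<in> cdom b T"
  "bproj M (fcurve t) = bproj M p"
  "coord b T (fcurve t) = flp b T (bproj M p) t (coord b T p)"
  using param_shift[OF bT p, of "flp b T (bproj M p) t (coord b T p)"]
  by (auto simp: fib_idx_eq jc.flow_poly_fixed)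

lemma fcurve_integral: "integral_curve M X fcurve"
  unfolding integral_curve_def has_velocity_def
proof (intro conjI allI impI)
  show "smooth_into (total_atlas M) UNIV fcurve"
    by (rule smooth_into_param[OF bT open_UNIV jc.smooth_flow_poly]) (simp_all add: fcurve)
  fix t f assume f: "smooth_fun M f"
  show "((\<lambda>s. f (fcurve s)) has_real_derivative X f (fcurve t)) (at t)"
    by (rule X_chain[OF bT _ _ f]) (simp_all only: fcurve p jc.flow_poly_vderiv)
qed

text \<open>An integral curve cannot leave its fibre, so its coordinates in one chart satisfy the
  triangular system for all times; smooth test functions on the total space are the only access to
  them.\<close>

lemma integral_curve_unique:
  assumes "integral_curve M X \<gamma>" "\<gamma> 0 = p"
  shows "\<gamma> t = fcurve t"
proof -
  have v: "has_velocity M \<gamma> t X" for t using assms unfolding integral_curve_def by blast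
  have base: "bproj M (\<gamma> t) = bproj M p" for t using curve_base[OF v] assms by simp
  have eq: "coord b T (\<gamma> t) $ i = flp b T (bproj M p) t (coord b T (\<gamma> 0)) $ i" if "i \<in> JF" for t i
    by (rule jc.flow_poly_unique[of "\<lambda>t. coord b T (\<gamma> t)"])
      (use curve_coord[OF bT p v base] that in \<open>simp_all only: fib_idx_eq\<close>)
  show ?thesis
    by (rule fibre_eqI[OF bT]) (simp_all only: base p fcurve eq assms)
qed

text \<open>The flow is a definite description of a whole curve, so uniqueness is needed as an
  equality of functions on the real line.\<close>

lemma flow_eq: "flow M X t p = fcurve t"
proof -
  have "integral_curve M X fcurve \<and> fcurve 0 = p"
    using fcurve_integral by (simp only: jc.flow_poly_0 param_coord[OF bT p])
  moreover have "\<gamma> = fcurve" if "integral_curve M X \<gamma> \<and> \<gamma> 0 = p" for \<gamma>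
  proof
    fix t show "\<gamma> t = fcurve t"
      by (rule integral_curve_unique[OF conjunct1[OF that] conjunct2[OF that]])
  qed
  ultimately have "(THE \<gamma>. integral_curve M X \<gamma> \<and> \<gamma> 0 = p) = fcurve"
    by (rule the_equality)
  then show ?thesis unfolding flow_def by (rule fun_cong)
qed

end

section \<open>Extensions of the action\<close>

abbreviation "coefficients_vanish \<equiv>
  \<forall>b\<in>base_atlas M. \<forall>T\<in>trivs M. \<forall>x \<in> fst b \<inter> fst T.
     (\<forall>s\<in>J1. F b T s x = 0) \<and>
     (\<forall>\<sigma>\<in>J3. \<forall>s\<in>J1. (\<Sum>S\<in>J2. H b T \<sigma> S x * G b T S s x) = 0)"

abbreviation "HGvec b T x v \<equiv> lin_part J2 (\<lambda>\<sigma> S. H b T \<sigma> S x)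
  (jet_coefficients.gvec J1 (\<lambda>S s. G b T S s x) v)"

section \<open>Necessity: limits as the first jet component tends to zero\<close>

lemma fibre_point:
  assumes bT: "b \<in> base_atlas M" "T \<in> trivs M" and x: "x \<in> fst b" "x \<in> fst T"
  obtains p where "bproj M p = x" "\<forall>i\<in>JF. coord b T p $ i = y $ i"
proof -
  obtain p where p: "bproj M p = x" "snd T p = restr JF y"
    using triv_surj[OF bT(2) x(2) restr_in_coord_space] by blast
  have "\<forall>i\<in>JF. coord b T p $ i = y $ i"
    using coord_nth(1)[OF bT, of p] p x by (simp add: restr_def)
  with p(1) show ?thesis by (rule that)
qed

text \<open>The point of the fibre whose fibre coordinates form the unit vector
  \<open>axis s 1\<close> singles out column \<open>s\<close> of \<open>H G\<close>.\<close>

lemma HG_eq_0I: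
  assumes bT: "b \<in> base_atlas M" "T \<in> trivs M" and x: "x \<in> fst b" "x \<in> fst T" and s: "s \<in> J1"
    and z: "\<And>p. bproj M p = x \<Longrightarrow> HGvec b T x (coord b T p) \<sigma> = 0"
  shows "(\<Sum>S\<in>J2. H b T \<sigma> S x * G b T S s x) = 0"
proof -
  obtain p where p: "bproj M p = x" "\<forall>i\<in>JF. coord b T p $ i = axis s 1 $ i"
    by (rule fibre_point[OF bT x, where y = "axis s 1"])
  have "0 = (\<Sum>r\<in>J1. (\<Sum>S\<in>J2. H b T \<sigma> S x * G b T S r x) * coord b T p $ r)"
    using z[OF p(1)] unfolding jc.lin_part_gvec by simp
  also have "\<dots> = (\<Sum>r\<in>J1. (\<Sum>S\<in>J2. H b T \<sigma> S x * G b T S r x) * (if r = s then 1 else 0))"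
    using p(2) by (intro sum.cong) (auto simp: fib_idx_eq axis_def)
  also have "\<dots> = (\<Sum>S\<in>J2. H b T \<sigma> S x * G b T S s x)"
    using s by (simp add: if_distrib cong: if_cong)
  finally show ?thesis by simp
qed

lemma inv_action_coord:
  assumes bT: "b \<in> base_atlas M" "T \<in> trivs M" and p: "bproj M p \<in> fst b" "bproj M p \<in> fst T"
  shows "bproj M (G2_inv_action M X p (a, \<beta>)) = bproj M p"
    "coord b T (G2_inv_action M X p (a, \<beta>)) =
       flp b T (bproj M p) (\<beta> / a) (coord b T (homothety M a p))"
  using flow_eq[OF bT, of "homothety M a p"] fcurve[OF bT, of "homothety M a p"] p
  by (simp_all add: G2_inv_action_def bproj_homothety)

lemma homothety_coord3:
  assumes bT: "b \<in> base_atlas M" "T \<in> trivs M" and p: "bproj M p \<in> fst b" "bproj M p \<in> fst T"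
  shows "i \<in> J1 \<Longrightarrow> coord b T (homothety M a p) $ i = a * coord b T p $ i"
    "i \<in> J2 \<Longrightarrow> coord b T (homothety M a p) $ i = a\<^sup>2 * coord b T p $ i"
    "i \<in> J3 \<Longrightarrow> coord b T (homothety M a p) $ i = a ^ 3 * coord b T p $ i"
    "i \<notin> J1 \<Longrightarrow> i \<notin> J2 \<Longrightarrow> i \<notin> J3 \<Longrightarrow> coord b T (homothety M a p) $ i = coord b T p $ i"
proof -
  note h = homothety_coord[OF bT p, of a i]
  show "i \<in> J1 \<Longrightarrow> coord b T (homothety M a p) $ i = a * coord b T p $ i"
    "i \<in> J2 \<Longrightarrow> coord b T (homothety M a p) $ i = a\<^sup>2 * coord b T p $ i"
    "i \<in> J3 \<Longrightarrow> coord b T (homothety M a p) $ i = a ^ 3 * coord b T p $ i"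
    using h by (simp_all add: idx_of_def)
  show "coord b T (homothety M a p) $ i = coord b T p $ i"
    if "i \<notin> J1" "i \<notin> J2" "i \<notin> J3"
    using that fib_idx_eq coord_nth(2)[OF bT, of _ i] p by (simp add: bproj_homothety)
qed

text \<open>Along the jets \<open>(a, 1)\<close> an extended action has convergent coordinates, so
  \<open>a\<close> times a coordinate tends to 0. A simple pole of the flow formula at
  \<open>a = 0\<close> therefore has residue 0.\<close>

lemma extension_limit:
  assumes \<rho>: "smooth_right_G2_action M \<rho>"
    "\<And>p a b. a \<noteq> 0 \<Longrightarrow> \<rho> p (a, b) = G2_inv_action M X p (a, b)"
    and bT: "b \<in> base_atlas M" "T \<in> trivs M" and p: "bproj M p \<in> fst b" "bproj M p \<in> fst T"
    and lim: "((\<lambda>a. a * flp b T (bproj M p) (1 / a) (coord b T (homothety M a p)) $ i) \<longlongrightarrow> l) (at 0)"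
  shows "l = 0"
proof -
  let ?r = "\<lambda>a. \<rho> p (a, 1)"
  let ?c = "graded_chart M b T"
  have "?c \<in> total_atlas M" using bT unfolding total_atlas_def by blast
  then have "continuous_on (cdom b T \<times> UNIV) (\<lambda>(v, g). \<rho> (param b T v) g)"
    using \<rho>(1) unfolding smooth_right_G2_action_def smooth_into_def by blast
  then have "continuous_on UNIV (\<lambda>a. (\<lambda>(v, g). \<rho> (param b T v) g) (coord b T p, (a, 1::real)))"
    by (rule continuous_on_compose2)
      (auto intro!: continuous_intros simp: param_coord[OF bT p])
  then have r: "continuous_on UNIV ?r" by (simp add: param_coord[OF bT p])
  have base: "bproj M (?r a) = bproj M p" if "a \<noteq> 0" for a
    using inv_action_coord(1)[OF bT p] \<rho>(2)[OF that] by simp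
  \<comment> \<open>To use coordinates at \<open>a = 0\<close>, the limit point must lie in the
    chart. Its base point is the limit of a constant, and limits in the base are unique.\<close>
  have "continuous_on UNIV (\<lambda>a. bproj M (?r a))"
    by (rule continuous_on_compose2[OF continuous_bproj r]) simp
  then have "((\<lambda>a. bproj M (?r a)) \<longlongrightarrow> bproj M (?r 0)) (at 0)"
    by (simp add: continuous_on_def)
  moreover have "((\<lambda>a. bproj M (?r a)) \<longlongrightarrow> bproj M p) (at 0)"
    by (rule Lim_transform_eventually[OF tendsto_const])
      (auto simp: eventually_at_filter base)
  ultimately have "bproj M (?r 0) = bproj M p" by (rule tendsto_unique[rotated]) simp
  with base have mem: "?r a \<in> fst ?c" for a using p by (cases "a = 0") (auto simp: mem_chart)
  have "continuous_on UNIV (\<lambda>a. coord b T (?r a))"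
    by (rule continuous_on_compose2[OF continuous_on_chart[OF total_chart[OF bT]] r])
      (use mem in auto)
  then have "continuous_on UNIV (\<lambda>a. a * coord b T (?r a) $ i)"
    by (intro continuous_intros)
  then have "((\<lambda>a. a * coord b T (?r a) $ i) \<longlongrightarrow> 0 * coord b T (?r 0) $ i) (at 0)"
    unfolding continuous_on_def by blast
  moreover have "((\<lambda>a. a * coord b T (?r a) $ i) \<longlongrightarrow> l) (at 0)"
    by (rule Lim_transform_eventually[OF lim])
      (auto simp: eventually_at_filter \<rho>(2) inv_action_coord[OF bT p])
  ultimately show ?thesis using tendsto_unique[of "at (0::real)"] by simp
qed

text \<open>\<open>F\<close> is treated before \<open>H G\<close>: it appears as a simple pole in
  weight 1, and once it is zero the flow in weight 3 is quadratic in time, so the worst pole there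
  is simple as well.\<close>

lemma extends_imp_vanish:
  assumes "extends_to_G2_action M X"
  shows coefficients_vanish
proof (intro ballI)
  obtain \<rho> where \<rho>: "smooth_right_G2_action M \<rho>"
    "\<And>p a b. a \<noteq> 0 \<Longrightarrow> \<rho> p (a, b) = G2_inv_action M X p (a, b)"
    using assms unfolding extends_to_G2_action_def by blast
  fix b T x
  assume bT: "b \<in> base_atlas M" "T \<in> trivs M" and "x \<in> fst b \<inter> fst T"
  then have x: "x \<in> fst b" "x \<in> fst T" by auto
  have F0: "F b T s x = 0" if s: "s \<in> J1" for s
  proof -
    obtain p where "bproj M p = x" by (rule fibre_point[OF bT x])
    then have p: "bproj M p = x" "bproj M p \<in> fst b" "bproj M p \<in> fst T" using x by auto
    let ?v = "coord b T p"
    \<comment> \<open>This is \<open>a\<close> times the weight 1 coordinate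
      \<open>a * ?v $ s + F / a\<close> of the acted point.\<close>
    have "((\<lambda>a. a * (a * ?v $ s) + F b T s x) \<longlongrightarrow> 0 * (0 * ?v $ s) + F b T s x) (at 0)"
      by (intro tendsto_intros)
    then have "((\<lambda>a. a * (a * ?v $ s) + F b T s x) \<longlongrightarrow> F b T s x) (at 0)" by simp
    then have "((\<lambda>a. a * flp b T x (1 / a) (coord b T (homothety M a p)) $ s) \<longlongrightarrow> F b T s x) (at 0)"
      by (rule Lim_transform_eventually)
        (use s in \<open>auto simp: eventually_at_filter jc.flow_poly_def
            homothety_coord3[OF bT p(2,3)] field_simps\<close>)
    then show ?thesis using extension_limit[OF \<rho> bT p(2,3)] p(1) by blast
  qed
  have "(\<Sum>S\<in>J2. H b T \<sigma> S x * G b T S s x) = 0" if \<sigma>: "\<sigma> \<in> J3" and s: "s \<in> J1" for \<sigma> s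
  proof (rule HG_eq_0I[OF bT x s])
    fix p assume "bproj M p = x"
    then have p: "bproj M p = x" "bproj M p \<in> fst b" "bproj M p \<in> fst T" using x by auto
    let ?v = "coord b T p"
    let ?w = "\<lambda>a. coord b T (homothety M a p)"
    let ?K = "lin_part J2 (\<lambda>\<sigma> S. H b T \<sigma> S x) ?v \<sigma> + quad_part J1 (\<lambda>\<sigma> s r. I b T \<sigma> s r x) ?v ?v \<sigma>"
    let ?L = "HGvec b T x ?v \<sigma>"
    note h = homothety_coord3[OF bT p(2,3)]
    have l: "lin_part J2 (\<lambda>\<sigma> S. H b T \<sigma> S x) (?w a) \<sigma> = a\<^sup>2 * lin_part J2 (\<lambda>\<sigma> S. H b T \<sigma> S x) ?v \<sigma>" for a
      by (rule lin_part_scale) (rule h(2))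
    have q: "quad_part J1 (\<lambda>\<sigma> s r. I b T \<sigma> s r x) (?w a) (?w a) \<sigma> =
        a\<^sup>2 * quad_part J1 (\<lambda>\<sigma> s r. I b T \<sigma> s r x) ?v ?v \<sigma>" for a
      by (rule quad_part_scale) (rule h(1))
    have g: "HGvec b T x (?w a) \<sigma> = a * ?L" for a
      unfolding jc.lin_part_gvec by (simp add: h(1) sum_distrib_left algebra_simps)
    have not: "\<sigma> \<notin> J2" "\<sigma> \<notin> J1" using \<sigma> by (auto simp: idx_of_def)
    \<comment> \<open>At time 1/a, the scaling factors \<open>a\<^sup>2\<close> of \<open>?K\<close>
      and \<open>a\<close> of \<open>?L\<close> leave \<open>a * ?K\<close> and
      \<open>?L / (2 * a)\<close>; the extra factor \<open>a\<close> clears the pole.\<close>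
    have eq: "a * flp b T x (1 / a) (?w a) $ \<sigma> = a ^ 4 * ?v $ \<sigma> + a\<^sup>2 * ?K + ?L / 2"
      if "a \<noteq> 0" for a
    proof -
      have "flp b T x (1 / a) (?w a) $ \<sigma> = a ^ 3 * ?v $ \<sigma> + 1 / a * (a\<^sup>2 * ?K) + (1 / a)\<^sup>2 / 2 * (a * ?L)"
        using jc.flow_poly_F0[where b=b and T=T and x=x, OF F0] \<sigma> not
        by (simp add: l q g h(3) algebra_simps)
      then show ?thesis using that
        by (simp add: field_simps power2_eq_square power3_eq_cube power4_eq_xxxx del: mult_cancel_left)
    qed
    have "((\<lambda>a. a ^ 4 * ?v $ \<sigma> + a\<^sup>2 * ?K + ?L / 2) \<longlongrightarrow> 0 ^ 4 * ?v $ \<sigma> + 0\<^sup>2 * ?K + ?L / 2) (at 0)"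
      by (intro tendsto_intros)
    then have "((\<lambda>a. a ^ 4 * ?v $ \<sigma> + a\<^sup>2 * ?K + ?L / 2) \<longlongrightarrow> ?L / 2) (at 0)" by simp
    then have "((\<lambda>a. a * flp b T x (1 / a) (?w a) $ \<sigma>) \<longlongrightarrow> ?L / 2) (at 0)"
      by (rule Lim_transform_eventually) (auto simp: eventually_at_filter eq)
    then have "?L / 2 = 0" using extension_limit[OF \<rho> bT p(2,3)] p(1) by blast
    then show "?L = 0" by simp
  qed
  with F0 show "(\<forall>s\<in>J1. F b T s x = 0) \<and>
     (\<forall>\<sigma>\<in>J3. \<forall>s\<in>J1. (\<Sum>S\<in>J2. H b T \<sigma> S x * G b T S s x) = 0)" by blast
qed

section \<open>Sufficiency: construction of the extension\<close>

lemma coefficient_smooth: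
  assumes bT: "b \<in> base_atlas M" "T \<in> trivs M"
    and k: "smooth_fun_on J0 (base_atlas M) (fst b \<inter> fst T) k"
  shows "smooth_on (cdom b T) (\<lambda>v. k (bproj M (param b T v)))"
proof -
  note bp = bproj_param[OF bT]
  have "smooth_on {v \<in> chart_dom J0 b. chart_param J0 b v \<in> fst b \<inter> fst T}
      (\<lambda>v. k (chart_param J0 b v))"
    using k bT unfolding smooth_fun_on_def by blast
  then have "smooth_on (cdom b T) (\<lambda>v. k (chart_param J0 b v))"
    by (rule smooth_on_subset) (use bp in fastforce)
  then show ?thesis
    by (rule smooth_on_cong[OF open_chart_dom[OF total_chart[OF bT]], rotated]) (simp add: bp(4))
qed

lemma local_form_smooth:
  assumes "b \<in> base_atlas M" "T \<in> trivs M"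
  shows "S \<in> J2 \<Longrightarrow> s \<in> J1 \<Longrightarrow> smooth_fun_on J0 (base_atlas M) (fst b \<inter> fst T) (G b T S s)"
    "\<sigma> \<in> J3 \<Longrightarrow> S \<in> J2 \<Longrightarrow> smooth_fun_on J0 (base_atlas M) (fst b \<inter> fst T) (H b T \<sigma> S)"
    "\<sigma> \<in> J3 \<Longrightarrow> s \<in> J1 \<Longrightarrow> r \<in> J1 \<Longrightarrow>
      smooth_fun_on J0 (base_atlas M) (fst b \<inter> fst T) (I b T \<sigma> s r)"
  using local_form[OF assms] unfolding local_form_def Let_def by blast+

text \<open>The candidate for the extension, still tied to one chart and one trivialization.\<close>

definition jet_act :: "('b, 'i) chart \<Rightarrow> 'b set \<times> ('m \<Rightarrow> real ^ 'i) \<Rightarrow> 'm \<Rightarrow> real \<times> real \<Rightarrow> 'm" where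
  "jet_act b T p g = param b T (jetp b T (bproj M p) g (coord b T p))"

lemma jet_act:
  assumes bT: "b \<in> base_atlas M" "T \<in> trivs M" and p: "bproj M p \<in> fst b" "bproj M p \<in> fst T"
  shows "jetp b T (bproj M p) g (coord b T p) \<in> cdom b T"
    "bproj M (jet_act b T p g) = bproj M p"
    "coord b T (jet_act b T p g) = jetp b T (bproj M p) g (coord b T p)"
  using param_shift[OF bT p, of "jetp b T (bproj M p) g (coord b T p)"]
  by (auto simp: fib_idx_eq jc.jet_poly_fixed jet_act_def)

lemma continuous_jet_act:
  assumes bT: "b \<in> base_atlas M" "T \<in> trivs M" and p: "bproj M p \<in> fst b" "bproj M p \<in> fst T"
  shows "continuous_on UNIV (jet_act b T p)"
proof -
  have "continuous_on UNIV (\<lambda>g. jetp b T (bproj M p) g (coord b T p))"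
    using smooth_on_continuous jc.smooth_jet_poly by blast
  then have "continuous_on UNIV (\<lambda>g. param b T (jetp b T (bproj M p) g (coord b T p)))"
    by (rule continuous_on_compose2[OF continuous_on_chart_param[OF total_chart[OF bT]]])
      (use jet_act(1)[OF bT p] in auto)
  then show ?thesis by (simp add: jet_act_def[abs_def])
qed

lemma jet_act_scaled:
  assumes bT: "b \<in> base_atlas M" "T \<in> trivs M" and p: "bproj M p \<in> fst b" "bproj M p \<in> fst T"
  shows "jet_act b T p (a, a\<^sup>2 * t) = homothety M a (jet_act b T p (1, t))"
proof (rule fibre_eqI[OF bT])
  let ?q = "jet_act b T p (1, t)"
  have q: "bproj M ?q \<in> fst b" "bproj M ?q \<in> fst T" using jet_act(2)[OF bT p] p by auto
  fix i
  show "coord b T (jet_act b T p (a, a\<^sup>2 * t)) $ i = coord b T (homothety M a ?q) $ i"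
    unfolding jet_act(3)[OF bT p]
    using jc.jet_poly_scaled[where b=b and T=T and x="bproj M p" and i=i]
      homothety_coord3[OF bT q, of i] jet_act(3)[OF bT p]
    by (cases i rule: jc.idx3_cases) simp_all
qed (simp_all add: jet_act(2)[OF bT p] p bproj_homothety)

context
  assumes vanish: coefficients_vanish
begin

lemma vanish_F: "b \<in> base_atlas M \<Longrightarrow> T \<in> trivs M \<Longrightarrow> x \<in> fst b \<Longrightarrow> x \<in> fst T \<Longrightarrow>
    s \<in> J1 \<Longrightarrow> F b T s x = 0"
  using vanish by simp

lemma vanish_HG: "b \<in> base_atlas M \<Longrightarrow> T \<in> trivs M \<Longrightarrow> x \<in> fst b \<Longrightarrow> x \<in> fst T \<Longrightarrow>
    \<sigma> \<in> J3 \<Longrightarrow> s \<in> J1 \<Longrightarrow> (\<Sum>S\<in>J2. H b T \<sigma> S x * G b T S s x) = 0"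
  using vanish by simp

lemma jet_act_inv:
  assumes bT: "b \<in> base_atlas M" "T \<in> trivs M" and p: "bproj M p \<in> fst b" "bproj M p \<in> fst T"
    and a: "a \<noteq> 0"
  shows "jet_act b T p (a, \<beta>) = G2_inv_action M X p (a, \<beta>)"
proof (rule fibre_eqI[OF bT])
  show "coord b T (jet_act b T p (a, \<beta>)) $ i = coord b T (G2_inv_action M X p (a, \<beta>)) $ i" for i
    unfolding jet_act(3)[OF bT p] inv_action_coord[OF bT p]
    using jc.flow_poly_scaled[where b=b and T=T and x="bproj M p", OF vanish_F[OF bT p]
      vanish_HG[OF bT p] a homothety_coord3[OF bT p]] by simp
qed (simp_all add: jet_act(2)[OF bT p] p inv_action_coord[OF bT p])

text \<open>For \<open>a \<noteq> 0\<close> the value is determined by the flow, which does not refer to a chart; the case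
  \<open>a = 0\<close> follows by continuity.\<close>

lemma jet_act_chart_independent:
  assumes bT: "b \<in> base_atlas M" "T \<in> trivs M" and p: "bproj M p \<in> fst b" "bproj M p \<in> fst T"
    and bT': "b' \<in> base_atlas M" "T' \<in> trivs M" and p': "bproj M p \<in> fst b'" "bproj M p \<in> fst T'"
  shows "jet_act b T p g = jet_act b' T' p g"
proof -
  obtain a \<beta> where g: "g = (a, \<beta>)" by (cases g)
  have eq: "jet_act b T p (t, \<beta>) = jet_act b' T' p (t, \<beta>)" if "t \<noteq> 0" for t
    using jet_act_inv[OF bT p that] jet_act_inv[OF bT' p' that] by simp
  have lim: "((\<lambda>t. jet_act c U p (t, \<beta>)) \<longlongrightarrow> jet_act c U p (0, \<beta>)) (at 0)"
    if "c \<in> base_atlas M" "U \<in> trivs M" "bproj M p \<in> fst c" "bproj M p \<in> fst U" for c U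
  proof -
    have "continuous_on UNIV (\<lambda>t. jet_act c U p (t, \<beta>))"
      by (rule continuous_on_compose2[OF continuous_jet_act[OF that]])
        (auto intro!: continuous_intros)
    then show ?thesis unfolding continuous_on_def by blast
  qed
  have "((\<lambda>t. jet_act b T p (t, \<beta>)) \<longlongrightarrow> jet_act b' T' p (0, \<beta>)) (at 0)"
    by (rule Lim_transform_eventually[OF lim[OF bT' p']]) (auto simp: eventually_at_filter eq)
  from tendsto_unique[OF _ lim[OF bT p] this]
  have "jet_act b T p (0, \<beta>) = jet_act b' T' p (0, \<beta>)" by simp
  then show ?thesis using eq g by (cases "a = 0") auto
qed

text \<open>Joint smoothness in the point and the jet. The coordinates of the image are polynomial
  in the fibre coordinates and in \<open>g\<close>, with coefficients that are smooth in the base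
  coordinates.\<close>

lemma smooth_jet_act:
  assumes bT: "b \<in> base_atlas M" "T \<in> trivs M"
    and k: "\<And>v g. v \<in> cdom b T \<Longrightarrow> k (v, g) = jet_act b T (param b T v) g"
  shows "smooth_into (total_atlas M) (cdom b T \<times> UNIV) k"
proof (rule smooth_into_param[OF bT])
  let ?S = "cdom b T \<times> (UNIV :: (real \<times> real) set)"
  let ?x = "\<lambda>e::(real ^ 'i) \<times> real \<times> real. bproj M (param b T (fst e))"
  \<comment> \<open>Vectors in \<open>cdom b T\<close> have arbitrary components outside
    \<open>idx M\<close>; restricting gives the actual coordinates of the point.\<close>
  let ?w = "\<lambda>e. jetp b T (?x e) (snd e) (restr (idx M) (fst e))"
  note ch = total_chart[OF bT]
  show op: "open ?S" by (simp add: open_Times open_chart_dom[OF ch])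
  have bl: "smooth_on ?S (\<lambda>e. L e)" if "bounded_linear L" for L :: "_ \<Rightarrow> real"
    using smooth_on_bounded_linear[OF op that] .
  have lin: "bounded_linear (\<lambda>e::(real ^ 'i) \<times> real \<times> real. fst (snd e))"
    "bounded_linear (\<lambda>e::(real ^ 'i) \<times> real \<times> real. snd (snd e))"
    "bounded_linear (\<lambda>e::(real ^ 'i) \<times> real \<times> real. restr (idx M) (fst e) $ i)" for i
    by (auto intro!: bounded_linear_intros
        bounded_linear_compose[OF bounded_linear_vec_nth]
        bounded_linear_compose[OF bounded_linear_restr] bounded_linear_fst_comp
        bounded_linear_snd_comp)
  have co: "smooth_on ?S (\<lambda>e. k (?x e))"
    if "smooth_fun_on J0 (base_atlas M) (fst b \<inter> fst T) k" for k :: "'b \<Rightarrow> real"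
    by (rule smooth_on_compose[OF op open_chart_dom[OF ch] _ _ coefficient_smooth[OF bT that]])
      (auto intro: smooth_on_bounded_linear[OF op] bounded_linear_fst)
  show "smooth_on ?S ?w"
  proof (rule smooth_on_vec[OF op])
    fix i
    show "smooth_on ?S (\<lambda>e. ?w e $ i)"
      by (cases i rule: jc.idx3_cases; simp only: jc.jet_poly_def vec_lambda_beta if_True if_False
          simp_thms lin_part_def quad_part_def)
        (intro smooth_on_add smooth_on_mult smooth_on_power smooth_on_sum smooth_on_const op
          bl lin co local_form_smooth[OF bT]; assumption)+
  qed
  fix e assume e: "e \<in> ?S"
  then have v: "fst e \<in> cdom b T" by auto
  note p = bproj_param(1,2)[OF bT v]
  have c: "coord b T (param b T (fst e)) = restr (idx M) (fst e)" by (rule chart_param_dom(2)[OF ch v])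
  show "?w e \<in> cdom b T" using jet_act(1)[OF bT p] unfolding c .
  show "k e = param b T (?w e)"
    using k[OF v, of "snd e"] by (simp add: jet_act_def c)
qed

lemma vanish_imp_extends: "extends_to_G2_action M X"
proof -
  have "\<exists>c. fst c \<in> base_atlas M \<and> snd c \<in> trivs M \<and> x \<in> fst (fst c) \<and> x \<in> fst (snd c)" for x
  proof -
    obtain b T where "b \<in> base_atlas M" "T \<in> trivs M" "x \<in> fst b" "x \<in> fst T" by (rule base_cover)
    then show ?thesis by (intro exI[of _ "(b, T)"]) simp
  qed
  then obtain c where c: "\<And>x. fst (c x) \<in> base_atlas M \<and> snd (c x) \<in> trivs M \<and>
      x \<in> fst (fst (c x)) \<and> x \<in> fst (snd (c x))"
    by metis
  \<comment> \<open>The chart is chosen by base point, in a possibly discontinuous way. Chart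
    independence replaces it by any fixed chart near a point, which is how smoothness is
    obtained.\<close>
  define \<rho> where "\<rho> p g = jet_act (fst (c (bproj M p))) (snd (c (bproj M p))) p g" for p g
  have \<rho>: "\<rho> p g = jet_act b T p g"
    if "b \<in> base_atlas M" "T \<in> trivs M" "bproj M p \<in> fst b" "bproj M p \<in> fst T" for b T p g
    unfolding \<rho>_def using jet_act_chart_independent[OF _ _ _ _ that] c by simp
  have smooth: "smooth_into (total_atlas M) (cdom b T \<times> UNIV) (\<lambda>(v, g). \<rho> (param b T v) g)"
    if bT: "b \<in> base_atlas M" "T \<in> trivs M" for b T
    by (rule smooth_jet_act[OF bT]) (simp add: \<rho>[OF bT] bproj_param(1,2)[OF bT])
  have one: "\<rho> p G2_one = p" for p
  proof -
    obtain b T where bT: "b \<in> base_atlas M" "T \<in> trivs M"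
      and p: "bproj M p \<in> fst b" "bproj M p \<in> fst T" by (rule base_cover)
    show ?thesis by (simp add: \<rho>[OF bT p] jet_act_def jc.jet_poly_one param_coord[OF bT p])
  qed
  have mult: "\<rho> (\<rho> p g) h = \<rho> p (G2_mult g h)" for p g h
  proof -
    obtain b T where bT: "b \<in> base_atlas M" "T \<in> trivs M"
      and p: "bproj M p \<in> fst b" "bproj M p \<in> fst T" by (rule base_cover)
    let ?q = "jet_act b T p g"
    \<comment> \<open>The base point is preserved, so both factors act in the same chart with the
      same coefficients, and the polynomial identity applies.\<close>
    have q: "bproj M ?q \<in> fst b" "bproj M ?q \<in> fst T" using p jet_act(2)[OF bT p] by auto
    have "\<rho> (\<rho> p g) h = jet_act b T ?q h" using \<rho>[OF bT p] \<rho>[OF bT q] by simp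
    also have "\<dots> = jet_act b T p (G2_mult g h)"
      unfolding jet_act_def[of b T ?q] jet_act(2,3)[OF bT p] jet_act_def[of b T p "G2_mult g h"]
      using jc.jet_poly_mult[where b=b and T=T and x="bproj M p", OF vanish_F[OF bT p]
        vanish_HG[OF bT p]] by simp
    finally show ?thesis using \<rho>[OF bT p] by simp
  qed
  have "smooth_right_G2_action M \<rho>"
    unfolding smooth_right_G2_action_def total_atlas_def using smooth one mult
    unfolding total_atlas_def by auto
  moreover have "\<rho> p (a, \<beta>) = G2_inv_action M X p (a, \<beta>)" if "a \<noteq> 0" for p a \<beta>
    unfolding \<rho>_def using jet_act_inv[OF _ _ _ _ that] c by simp
  ultimately show ?thesis unfolding extends_to_G2_action_def by blast
qed

end

section \<open>Tangency and the operator \<open>X \<circ> X\<close>\<close>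

lemma vanish_imp_tangent:
  assumes vanish: coefficients_vanish
  shows "tangent_to_M1_fibres M X"
  unfolding tangent_to_M1_fibres_def
proof
  fix p
  obtain b T where bT: "b \<in> base_atlas M" "T \<in> trivs M"
    and p: "bproj M p \<in> fst b" "bproj M p \<in> fst T" by (rule base_cover)
  define \<gamma> where "\<gamma> t = param b T (flp b T (bproj M p) t (coord b T p))" for t
  have int: "integral_curve M X \<gamma>"
    unfolding \<gamma>_def[abs_def] by (rule fcurve_integral[OF bT p])
  have base: "bproj M (\<gamma> t) = bproj M p" for t
    unfolding \<gamma>_def by (rule fcurve(2)[OF bT p])
  have start: "\<gamma> 0 = p" by (simp add: \<gamma>_def jc.flow_poly_0 param_coord[OF bT p])
  have vel: "has_velocity M \<gamma> t X" for t using int unfolding integral_curve_def by blast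
  \<comment> \<open>Membership in the fibre over the degree 1 quotient is tested in all
    trivializations. In each of them \<open>F\<close> is zero, so the weight 1 coordinates are
    constant along the flow line.\<close>
  have "snd T' (\<gamma> t) $ i = snd T' p $ i"
    if T': "T' \<in> trivs M" "bproj M p \<in> fst T'" and i: "i \<in> J1" for T' i t
  proof -
    note bT' = bT(1) T'(1) and p' = p(1) T'(2)
    have "((\<lambda>s. coord b T' (\<gamma> s) $ i) has_real_derivative 0) (at s)" for s
      using curve_coord[OF bT' p' vel base, of i s] i vanish bT' p'
      by (simp add: fib_idx_eq jc.velocity_def)
    then have "coord b T' (\<gamma> t) $ i = coord b T' (\<gamma> 0) $ i"
      by (intro DERIV_isconst_all) auto
    then show ?thesis
      using i coord_nth(1)[OF bT', of _ i] p' base start by (simp add: fib_idx_eq)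
  qed
  then have "\<gamma> t \<in> M1_proj M p" for t by (simp add: M1_proj_def base)
  with int start vel show "\<exists>\<gamma>. smooth_into (total_atlas M) UNIV \<gamma> \<and> \<gamma> 0 = p \<and>
            (\<forall>t. \<gamma> t \<in> M1_proj M p) \<and> has_velocity M \<gamma> 0 X"
    unfolding integral_curve_def by blast
qed

lemma X_smooth: "smooth_fun M f \<Longrightarrow> smooth_fun M (X f)"
  using field unfolding vector_field_def by blast

lemma vanish_imp_XX:
  assumes vanish: coefficients_vanish
    and f: "smooth_fun M f" "fun_has_weight M k f" and k: "k \<le> 3"
  shows "X (X f) p = 0"
proof -
  obtain b T where bT: "b \<in> base_atlas M" "T \<in> trivs M"
    and p: "bproj M p \<in> fst b" "bproj M p \<in> fst T" by (rule base_cover)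
  let ?x = "bproj M p" and ?v = "coord b T p"
  define \<gamma> where "\<gamma> t = param b T (flp b T ?x t ?v)" for t
  have start: "\<gamma> 0 = p" by (simp add: \<gamma>_def jc.flow_poly_0 param_coord[OF bT p])
  have vel: "has_velocity M \<gamma> t X" for t
    using fcurve_integral[OF bT p] unfolding \<gamma>_def[abs_def] integral_curve_def by blast
  \<comment> \<open>The gain over the flow is smoothness on the whole plane of jets, including
    \<open>a = 0\<close>; the derivatives in the second jet component thus have limits
    there.\<close>
  define \<psi> where "\<psi> g = f (jet_act b T p g)" for g
  have "graded_chart M b T \<in> total_atlas M" using bT unfolding total_atlas_def by blast
  then have smf: "smooth_on {v \<in> cdom b T. param b T v \<in> UNIV} (\<lambda>v. f (param b T v))"
    using f unfolding smooth_fun_on_def by blast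
  have "smooth_on UNIV (\<lambda>g. f (param b T (jetp b T ?x g ?v)))"
    by (rule smooth_on_compose[OF open_UNIV _ _ jc.smooth_jet_poly smf])
      (use jet_act(1)[OF bT p] open_chart_dom[OF total_chart[OF bT]] in auto)
  then have \<psi>: "smooth_on UNIV \<psi>" by (simp add: \<psi>_def[abs_def] jet_act_def)
  define \<psi>1 where "\<psi>1 g = frechet_derivative \<psi> (at g) (0, 1)" for g
  define \<psi>2 where "\<psi>2 g = frechet_derivative \<psi>1 (at g) (0, 1)" for g
  have \<psi>1: "smooth_on UNIV \<psi>1"
    unfolding \<psi>1_def[abs_def] by (rule smooth_on_frechet_derivative[OF \<psi>])
  have \<psi>2: "smooth_on UNIV \<psi>2"
    unfolding \<psi>2_def[abs_def] by (rule smooth_on_frechet_derivative[OF \<psi>1])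
  have d1: "((\<lambda>t. \<psi> (a, c * t)) has_real_derivative c * \<psi>1 (a, c * t)) (at t)" for a c t
    unfolding \<psi>1_def by (rule has_real_derivative_snd_line[OF \<psi>])
  have d2: "((\<lambda>t. \<psi>1 (a, c * t)) has_real_derivative c * \<psi>2 (a, c * t)) (at t)" for a c t
    unfolding \<psi>2_def by (rule has_real_derivative_snd_line[OF \<psi>1])
  \<comment> \<open>At \<open>a = 1\<close> the action is the flow itself, so derivatives in
    \<open>t\<close> compute \<open>X\<close> and \<open>X \<circ> X\<close>.\<close>
  have "jet_act b T p (1, t) = \<gamma> t" for t
    using jet_act_inv[OF vanish bT p, of 1 t] flow_eq[OF bT p, of t] homothety_coord[OF bT p, of 1]
      coord_inj[OF bT, of "homothety M 1 p" p] p
    by (simp add: G2_inv_action_def \<gamma>_def bproj_homothety vec_eq_iff)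
  then have \<psi>\<gamma>: "\<psi> (1, t) = f (\<gamma> t)" for t by (simp add: \<psi>_def)
  have "X f (\<gamma> t) = \<psi>1 (1, t)" for t
  proof (rule DERIV_unique)
    show "((\<lambda>s. f (\<gamma> s)) has_real_derivative X f (\<gamma> t)) (at t)"
      using vel f(1) unfolding has_velocity_def by blast
    show "((\<lambda>s. f (\<gamma> s)) has_real_derivative \<psi>1 (1, t)) (at t)"
      using d1[of 1 1 t] by (simp add: \<psi>\<gamma>)
  qed
  then have Xf: "(\<lambda>t. X f (\<gamma> t)) = (\<lambda>t. \<psi>1 (1, t))" by blast
  have XX: "X (X f) p = \<psi>2 (1, 0)"
  proof (rule DERIV_unique)
    show "((\<lambda>t. \<psi>1 (1, t)) has_real_derivative X (X f) p) (at 0)"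
      using vel[of 0] X_smooth[OF f(1)] start unfolding has_velocity_def Xf[symmetric] by metis
    show "((\<lambda>t. \<psi>1 (1, t)) has_real_derivative \<psi>2 (1, 0)) (at 0)"
      using d2[of 1 1 0] by simp
  qed
  have eq: "a ^ 4 * \<psi>2 (a, 0) = a ^ k * \<psi>2 (1, 0)" for a
  proof -
    have 0: "\<psi> (a, a\<^sup>2 * t) = a ^ k * \<psi> (1, t)" for t
      unfolding \<psi>_def jet_act_scaled[OF bT p] using f(2) unfolding fun_has_weight_def by blast
    have 1: "a\<^sup>2 * \<psi>1 (a, a\<^sup>2 * t) = a ^ k * \<psi>1 (1, t)" for t
    proof (rule DERIV_unique)
      show "((\<lambda>t. \<psi> (a, a\<^sup>2 * t)) has_real_derivative a\<^sup>2 * \<psi>1 (a, a\<^sup>2 * t)) (at t)" by (rule d1)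
      show "((\<lambda>t. \<psi> (a, a\<^sup>2 * t)) has_real_derivative a ^ k * \<psi>1 (1, t)) (at t)"
        unfolding 0 using DERIV_cmult[OF d1[of 1 1 t], of "a ^ k"] by simp
    qed
    have "a\<^sup>2 * (a\<^sup>2 * \<psi>2 (a, a\<^sup>2 * t)) = a ^ k * \<psi>2 (1, t)" for t
    proof (rule DERIV_unique)
      show "((\<lambda>t. a\<^sup>2 * \<psi>1 (a, a\<^sup>2 * t)) has_real_derivative a\<^sup>2 * (a\<^sup>2 * \<psi>2 (a, a\<^sup>2 * t))) (at t)"
        by (rule DERIV_cmult[OF d2])
      show "((\<lambda>t. a\<^sup>2 * \<psi>1 (a, a\<^sup>2 * t)) has_real_derivative a ^ k * \<psi>2 (1, t)) (at t)"
        unfolding 1 using DERIV_cmult[OF d2[of 1 1 t], of "a ^ k"] by simp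
    qed
    from this[of 0] show ?thesis by (simp add: power2_eq_square power4_eq_xxxx mult.assoc)
  qed
  have "continuous_on UNIV (\<lambda>a. \<psi>2 (a, 0))"
    by (rule continuous_on_compose2[OF smooth_on_continuous[OF \<psi>2]]) (auto intro!: continuous_intros)
  then have "((\<lambda>a. \<psi>2 (a, 0)) \<longlongrightarrow> \<psi>2 (0, 0)) (at 0)" unfolding continuous_on_def by blast
  \<comment> \<open>The subtraction is in the natural numbers; \<open>k \<le> 3\<close> makes the
    exponent positive, so the limit is 0.\<close>
  then have "((\<lambda>a. a ^ (4 - k) * \<psi>2 (a, 0)) \<longlongrightarrow> 0 ^ (4 - k) * \<psi>2 (0, 0)) (at 0)"
    by (intro tendsto_intros)
  then have "((\<lambda>a. a ^ (4 - k) * \<psi>2 (a, 0)) \<longlongrightarrow> 0) (at 0)"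
    using k by (simp add: zero_power)
  moreover have "a ^ (4 - k) * \<psi>2 (a, 0) = \<psi>2 (1, 0)" if "a \<noteq> 0" for a :: real
  proof -
    have "a ^ k * (a ^ (4 - k) * \<psi>2 (a, 0)) = a ^ k * \<psi>2 (1, 0)"
      using eq[of a] k by (simp add: power_add[symmetric] mult.assoc[symmetric])
    then show ?thesis using that by simp
  qed
  then have "((\<lambda>a. a ^ (4 - k) * \<psi>2 (a, 0)) \<longlongrightarrow> \<psi>2 (1, 0)) (at 0)"
    by (intro Lim_transform_eventually[OF tendsto_const]) (auto simp: eventually_at_filter)
  ultimately have "\<psi>2 (1, 0) = 0" using tendsto_unique[of "at (0::real)"] by simp
  then show ?thesis using XX by simp
qed

text \<open>Tangency yields \<open>F = 0\<close>. The second condition is then detected by the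
  weight 3 coordinates, along whose flow lines \<open>X f\<close> is affine in time with slope
  \<open>H G\<close> applied to the weight 1 coordinates.\<close>

lemma tangent_XX_imp_vanish:
  assumes tan: "tangent_to_M1_fibres M X"
    and XX: "\<And>f p. smooth_fun M f \<Longrightarrow> fun_has_weight M 3 f \<Longrightarrow> X (X f) p = 0"
  shows coefficients_vanish
proof (intro ballI)
  fix b T x
  assume bT: "b \<in> base_atlas M" "T \<in> trivs M" and "x \<in> fst b \<inter> fst T"
  then have x: "x \<in> fst b" "x \<in> fst T" by auto
  have F0: "F b T s x = 0" if s: "s \<in> J1" for s
  proof -
    obtain p where p: "bproj M p = x" by (rule fibre_point[OF bT x])
    obtain \<gamma> where \<gamma>: "\<gamma> 0 = p" "\<And>t. \<gamma> t \<in> M1_proj M p" "has_velocity M \<gamma> 0 X"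
      using tan unfolding tangent_to_M1_fibres_def by blast
    have base: "bproj M (\<gamma> t) = x" for t using \<gamma>(2)[of t] p by (simp add: M1_proj_def)
    have sJF: "s \<in> JF" using s by (simp add: fib_idx_eq)
    have const: "coord b T (\<gamma> t) $ s = coord b T p $ s" for t
      using \<gamma>(2)[of t] p bT x s coord_nth(1)[OF bT, of _ s] sJF base by (simp add: M1_proj_def)
    \<comment> \<open>The derivative of a weight 1 coordinate along the field is \<open>F\<close>,
      while this coordinate is constant on the fibre to which the field is tangent.\<close>
    have "((\<lambda>t. coord b T (\<gamma> t) $ s) has_real_derivative F b T s x) (at 0)"
      using curve_coord[OF bT x \<gamma>(3) base sJF] s by (simp add: jc.velocity_def)
    then have "((\<lambda>t. coord b T p $ s) has_real_derivative F b T s x) (at 0)"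
      unfolding const .
    then show ?thesis by (rule DERIV_unique) (rule DERIV_const)
  qed
  have "(\<Sum>S\<in>J2. H b T \<sigma> S x * G b T S s x) = 0" if \<sigma>: "\<sigma> \<in> J3" and s: "s \<in> J1" for \<sigma> s
  proof (rule HG_eq_0I[OF bT x s])
    fix p assume p: "bproj M p = x"
    then have px: "bproj M p \<in> fst b" "bproj M p \<in> fst T" using x by auto
    let ?v = "coord b T p"
    define \<gamma> where "\<gamma> t = param b T (flp b T x t ?v)" for t
    note fc = fcurve[OF bT px, unfolded p, folded \<gamma>_def]
    have start: "\<gamma> 0 = p" by (simp add: \<gamma>_def jc.flow_poly_0 param_coord[OF bT px])
    have vel: "has_velocity M \<gamma> t X" for t
      using fcurve_integral[OF bT px] unfolding p \<gamma>_def[abs_def] integral_curve_def by blast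
    have "\<sigma> \<in> JF" "wt M \<sigma> = 3" using \<sigma> by (auto simp: fib_idx_eq idx_of_def)
    then obtain f where f: "smooth_fun M f" "fun_has_weight M 3 f"
      "\<And>q. bproj M q = x \<Longrightarrow> f q = coord b T q $ \<sigma>"
      using fibre_coord_ex[OF bT x] by metis
    let ?H = "lin_part J2 (\<lambda>\<sigma> S. H b T \<sigma> S x)" and ?I = "quad_part J1 (\<lambda>\<sigma> s r. I b T \<sigma> s r x)"
    let ?F = "jet_coefficients.fvec (\<lambda>s. F b T s x)"
    have F0': "?F $ j = 0" if "j \<in> J1" for j
      using F0[OF that] by (simp add: jc.fvec_def)
    have gF: "HGvec b T x ?F \<sigma> = 0"
      unfolding jc.lin_part_gvec by (simp add: F0')
    have "X f (\<gamma> t) = ?H ?v \<sigma> + ?I ?v ?v \<sigma> + t * HGvec b T x ?v \<sigma>" for t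
      using X_fibre_coord[OF bT, of "\<gamma> t" f \<sigma>] f x fc(2)[of t] \<sigma>
      by (simp add: fc(3) jc.velocity_flow_poly(3) gF quad_part_0[OF F0'])
    then have eq: "(\<lambda>t. X f (\<gamma> t)) = (\<lambda>t. ?H ?v \<sigma> + ?I ?v ?v \<sigma> + t * HGvec b T x ?v \<sigma>)" by blast
    show "HGvec b T x ?v \<sigma> = 0"
    proof (rule DERIV_unique)
      show "((\<lambda>t. X f (\<gamma> t)) has_real_derivative HGvec b T x ?v \<sigma>) (at 0)"
        unfolding eq by (auto intro!: derivative_eq_intros)
      \<comment> \<open>Differentiating \<open>X f\<close> along the flow line gives
        \<open>X (X f)\<close> at \<open>p\<close>, which is zero by hypothesis.\<close>
      show "((\<lambda>t. X f (\<gamma> t)) has_real_derivative 0) (at 0)"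
        using vel[of 0] X_smooth[OF f(1)] start XX[OF f(1,2), of p] unfolding has_velocity_def by metis
    qed
  qed
  with F0 show "(\<forall>s\<in>J1. F b T s x = 0) \<and>
     (\<forall>\<sigma>\<in>J3. \<forall>s\<in>J1. (\<Sum>S\<in>J2. H b T \<sigma> S x * G b T S s x) = 0)" by blast
qed

end

theorem lemma4p5:
  fixes M :: "('m::{t2_space, second_countable_topology},
               'b::{t2_space, second_countable_topology}, 'i::finite) fibre_bundle"
    and X :: "('m \<Rightarrow> real) \<Rightarrow> ('m \<Rightarrow> real)"
    and F :: "('b, 'i) chart \<Rightarrow> 'b set \<times> ('m \<Rightarrow> real ^ 'i) \<Rightarrow> 'i \<Rightarrow> 'b \<Rightarrow> real"
    and G H :: "('b, 'i) chart \<Rightarrow> 'b set \<times> ('m \<Rightarrow> real ^ 'i) \<Rightarrow> 'i \<Rightarrow> 'i \<Rightarrow> 'b \<Rightarrow> real"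
    and I :: "('b, 'i) chart \<Rightarrow> 'b set \<times> ('m \<Rightarrow> real ^ 'i) \<Rightarrow> 'i \<Rightarrow> 'i \<Rightarrow> 'i \<Rightarrow> 'b \<Rightarrow> real"
  assumes "graded_bundle M" and "degree_at_most M 3"
    and "vector_field M X" and "vf_has_weight M (-1) X"
    and "\<forall>b\<in>base_atlas M. \<forall>T\<in>trivs M. local_form M b T X (F b T) (G b T) (H b T) (I b T)"
  shows "(extends_to_G2_action M X \<longleftrightarrow>
            (\<forall>b\<in>base_atlas M. \<forall>T\<in>trivs M. \<forall>x \<in> fst b \<inter> fst T.
               (\<forall>s\<in>idx_of M 1. F b T s x = 0) \<and>
               (\<forall>\<sigma>\<in>idx_of M 3. \<forall>s\<in>idx_of M 1.
                  (\<Sum>S\<in>idx_of M 2. H b T \<sigma> S x * G b T S s x) = 0)))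
       \<and> (extends_to_G2_action M X \<longleftrightarrow>
            (tangent_to_M1_fibres M X \<and>
             (\<forall>k f. k \<le> 3 \<longrightarrow> smooth_fun M f \<longrightarrow> fun_has_weight M k f \<longrightarrow>
                (\<forall>p. X (X f) p = 0))))"
proof -
  interpret weight_minus_one_field M X F G H I
    by unfold_locales (use assms in blast)+
  have "extends_to_G2_action M X \<longleftrightarrow> coefficients_vanish"
    using extends_imp_vanish vanish_imp_extends by blast
  moreover have "coefficients_vanish \<longleftrightarrow> tangent_to_M1_fibres M X \<and>
      (\<forall>k f. k \<le> 3 \<longrightarrow> smooth_fun M f \<longrightarrow> fun_has_weight M k f \<longrightarrow> (\<forall>p. X (X f) p = 0))"
    using vanish_imp_tangent vanish_imp_XX tangent_XX_imp_vanish by blast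
  ultimately show ?thesis by blast
qed

end
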